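(* If $n\geq 7$, then the nonnegative rank of any entrywise nonnegative $m$-by-$n$ matrix of (classical) rank $3$ is less than $n$. For each $k\in\{3,4,5,6\}$, there exists an entrywise nonnegative $k$-by-$k$ matrix of rank $3$ whose nonnegative rank equals $k$.
   Context: The nonnegative rank of a nonnegative matrix $A\in\mathbb{R}_+^{m\times n}$ is the smallest integer $k$ such that $A=BC$ for some entrywise nonnegative $B\in\mathbb{R}_+^{m\times k}$ and $C\in\mathbb{R}_+^{k\times n}$. *)

theory Defs
  imports "Jordan_Normal_Form.DL_Rank"
begin

definition nonneg_mat :: "real mat \<Rightarrow> bool" where
  "nonneg_mat A \<longleftrightarrow> (\<forall>i<dim_row A. \<forall>j<dim_col A. 0 \<le> A $$ (i, j))"

(* Meaningful for nonnegative A only: the minimum then exists (nonneg_rank_witness below). *)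
definition nonneg_rank :: "real mat \<Rightarrow> nat" where
  "nonneg_rank A = (LEAST k. \<exists>B \<in> carrier_mat (dim_row A) k. \<exists>C \<in> carrier_mat k (dim_col A).
     nonneg_mat B \<and> nonneg_mat C \<and> A = B * C)"

lemma nonneg_rank_witness:
  assumes A: "A \<in> carrier_mat m n" and nn: "nonneg_mat A"
  shows "\<exists>B \<in> carrier_mat m (nonneg_rank A). \<exists>C \<in> carrier_mat (nonneg_rank A) n.
     nonneg_mat B \<and> nonneg_mat C \<and> A = B * C"
proof -
  let ?P = "\<lambda>k. \<exists>B \<in> carrier_mat (dim_row A) k. \<exists>C \<in> carrier_mat k (dim_col A).
     nonneg_mat B \<and> nonneg_mat C \<and> A = B * C"
  have "nonneg_mat (1\<^sub>m n)" by (auto simp: nonneg_mat_def)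
  then have "?P n"
    using A nn by (intro bexI[of _ A] bexI[of _ "1\<^sub>m n"]) auto
  then have "?P (nonneg_rank A)" unfolding nonneg_rank_def by (rule LeastI)
  then show ?thesis using A by auto
qed

end

theory Submission
  imports Defs
begin

text \<open>
  Upper bound. It suffices to write seven columns in convex position as nonnegative combinations
  of six nonnegative vectors. Up to scaling, the rays of a convex heptagon satisfy a third-order
  recurrence whose coefficients form a frieze pattern. Two opposite sides at a vertex \<open>r\<close> meet in
  a point, and the line joining it to \<open>r\<close> leaves the heptagon through the edge opposite to \<open>r\<close> for
  some choice of \<open>r\<close>. For that \<open>r\<close> the heptagon is a section of a three-dimensional polytope with six
  vertices: seven of the nine sums of one of three upper and one of three lower vertices are the
  vertices of the heptagon, and the other two lie inside it.

  Lower bound. If a symmetric slack matrix of rank 3 factors through dimension 5, then one of the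
  two factors has its columns in a space that exceeds the column space by at most one dimension.
  Hence every vertex of the polygon is cut out by a pair of generators on opposite sides, or by a
  single generator. Few generators have few such pairs; six pairs from five generators force three
  lines through disjoint pairs of vertices of the hexagon to be concurrent, and the chosen hexagon
  has no such triple of lines.
\<close>

section \<open>Heptagons\<close>

definition conic_comb :: "nat \<Rightarrow> nat \<Rightarrow> (nat \<Rightarrow> nat \<Rightarrow> real) \<Rightarrow> (nat \<Rightarrow> real) \<Rightarrow> bool" where
  "conic_comb m k B v \<longleftrightarrow> (\<exists>c. (\<forall>t<k. 0 \<le> c t) \<and> (\<forall>i<m. v i = (\<Sum>t<k. B i t * c t)))"

definition nonneg_factor :: "nat \<Rightarrow> nat \<Rightarrow> nat \<Rightarrow> (nat \<Rightarrow> nat \<Rightarrow> real) \<Rightarrow> bool" where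
  "nonneg_factor m n k A \<longleftrightarrow>
     (\<exists>B. (\<forall>i<m. \<forall>t<k. 0 \<le> B i t) \<and> (\<forall>j<n. conic_comb m k B (\<lambda>i. A i j)))"

lemma conic_comb_pair:
  assumes "s < k" "t < k" "s \<noteq> t" "0 \<le> x" "\<And>i. i < m \<Longrightarrow> v i = x * (B i s + B i t)"
  shows "conic_comb m k B v"
proof -
  let ?c = "\<lambda>u. if u \<in> {s, t} then x else 0"
  have "v i = (\<Sum>u<k. B i u * ?c u)" if "i < m" for i
  proof -
    have "(\<Sum>u<k. B i u * ?c u) = (\<Sum>u\<in>{s, t}. B i u * ?c u)"
      using assms(1,2) by (intro sum.mono_neutral_right) auto
    then show ?thesis using assms(3) assms(5)[OF that] by (simp add: algebra_simps)
  qed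
  then show ?thesis unfolding conic_comb_def using assms(4) by (intro exI[of _ ?c]) auto
qed

text \<open>The remaining columns serve as the generators. In rank 3, three of them suffice for any
  element of their cone by Caratheodory's theorem; the indices \<open>i\<close>, \<open>k\<close>,
  \<open>l\<close> may coincide, which covers shorter combinations.\<close>

lemma nonneg_factor_redundant_column:
  assumes j: "j < n" and i: "i < n" "k < n" "l < n" and ne: "i \<noteq> j" "k \<noteq> j" "l \<noteq> j"
    and nn: "0 \<le> x" "0 \<le> y" "0 \<le> z"
    and A: "\<And>r s. r < m \<Longrightarrow> s < n \<Longrightarrow> 0 \<le> A r s"
    and eq: "\<And>r. r < m \<Longrightarrow> A r j = x * A r i + y * A r k + z * A r l"
  shows "nonneg_factor m n (n - 1) A"
proof -
  define f where "f t = (if t < j then t else Suc t)" for t :: nat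
  have bij: "bij_betw f {..<n - 1} ({..<n} - {j})"
    unfolding bij_betw_def
  proof
    show inj: "inj_on f {..<n - 1}"
      by (rule inj_onI) (simp add: f_def split: if_splits)
    have "f ` {..<n - 1} \<subseteq> {..<n} - {j}"
      using j by (auto simp: f_def)
    then show "f ` {..<n - 1} = {..<n} - {j}"
      using j card_image[OF inj] by (intro card_subset_eq) auto
  qed
  have comb: "conic_comb m (n - 1) (\<lambda>r t. A r (f t)) v"
    if c: "\<And>s. 0 \<le> c s" "c j = 0" "\<And>r. r < m \<Longrightarrow> v r = (\<Sum>s<n. A r s * c s)" for v and c :: "nat \<Rightarrow> real"
    unfolding conic_comb_def
  proof (intro exI conjI allI impI)
    show "0 \<le> (c \<circ> f) t" for t using c by simp
    fix r assume "r < m"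
    then have "v r = (\<Sum>s\<in>{..<n} - {j}. A r s * c s)"
      using c j by (simp add: sum.remove[of "{..<n}" j])
    also have "\<dots> = (\<Sum>t<n - 1. A r (f t) * (c \<circ> f) t)"
      using sum.reindex_bij_betw[OF bij, of "\<lambda>s. A r s * c s"] by simp
    finally show "v r = (\<Sum>t<n - 1. A r (f t) * (c \<circ> f) t)" .
  qed
  show ?thesis unfolding nonneg_factor_def
  proof (intro exI conjI allI impI)
    show "0 \<le> A r (f t)" if "r < m" "t < n - 1" for r t
      using A that by (auto simp: f_def)
    fix s assume s: "s < n"
    show "conic_comb m (n - 1) (\<lambda>r t. A r (f t)) (\<lambda>r. A r s)"
    proof (cases "s = j")
      case True
      let ?c = "\<lambda>u. (if u = i then x else 0) + (if u = k then y else 0) + (if u = l then z else 0)"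
      have "A r j = (\<Sum>u<n. A r u * ?c u)" if "r < m" for r
      proof -
        have delta: "(\<Sum>u<n. A r u * (if u = v then w else 0)) = w * A r v" if "v < n" for v w
          using that by (simp add: if_distrib cong: if_cong)
        show ?thesis unfolding eq[OF that] distrib_left sum.distrib using i by (simp only: delta)
      qed
      then show ?thesis using nn ne True by (intro comb[where c = ?c]) auto
    next
      case False
      let ?c = "\<lambda>u. if u = s then 1 else 0"
      have "A r s = (\<Sum>u<n. A r u * ?c u)" for r
        using s by (simp add: if_distrib cong: if_cong)
      then show ?thesis using False by (intro comb[where c = ?c]) auto
    qed
  qed
qed

section \<open>Frieze patterns of period 7\<close>

lemmas index_shift = add.assoc numeral_plus_numeral numeral_plus_one one_plus_numeral one_add_one add_num_simps

text \<open>In the cyclic sequence of length 14 that alternates \<open>b i, a i, b (i + 1), a (i + 1)\<close>, every term is at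
  most the product of its neighbours, so two terms at distance 3 have product at least 1.\<close>

lemma frieze_step:
  fixes a b :: "nat \<Rightarrow> real"
  assumes per: "\<And>i. a (i + 7) = a i" "\<And>i. b (i + 7) = b i"
    and pos: "\<And>i. 0 < a i" "\<And>i. 0 < b i"
    and ba: "\<And>i. b (i + 1) \<le> a i * a (i + 1)"
    and ab: "\<And>i. a i \<le> b i * b (i + 1)"
  shows "\<exists>r. 1 \<le> a (r + 1) \<and> 1 \<le> b (r + 3)"
proof (rule ccontr)
  assume neg: "\<not> ?thesis"
  \<comment> \<open>The instance \<open>r = i + 6\<close> stands for \<open>i - 1\<close>;
    periodicity removes the extra 7.\<close>
  have bad: "a i < 1 \<or> b (i + 2) < 1" for i
  proof -
    have "\<not> (1 \<le> a (i + 7) \<and> 1 \<le> b (i + 9))"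
      using neg[unfolded not_ex, rule_format, of "i + 6"] by (simp only: index_shift) simp
    then show ?thesis using per(1)[of i] per(2)[of "i + 2"] by (auto simp only: index_shift not_le de_Morgan_conj)
  qed
  have ba3: "1 \<le> b i * a (i + 1)" for i
  proof -
    have "a i * b (i + 1) \<le> (b i * b (i + 1)) * (a i * a (i + 1))"
      using ab ba pos by (intro mult_mono) (auto intro: less_imp_le)
    then have "a i * b (i + 1) * 1 \<le> a i * b (i + 1) * (b i * a (i + 1))" by (simp add: mult_ac)
    then show ?thesis using pos by (metis mult_le_cancel_left_pos mult_pos_pos)
  qed
  have ab3: "1 \<le> a i * b (i + 2)" for i
  proof -
    have "b (i + 1) * a (i + 1) \<le> (a i * a (i + 1)) * (b (i + 1) * b (i + 2))"
      using ab[of "i + 1"] ba[of i] pos by (intro mult_mono) (auto intro: less_imp_le)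
    then have "b (i + 1) * a (i + 1) * 1 \<le> b (i + 1) * a (i + 1) * (a i * b (i + 2))" by (simp add: mult_ac)
    then show ?thesis using pos by (metis mult_le_cancel_left_pos mult_pos_pos)
  qed
  have gt: "1 < y" if "1 \<le> x * y" "x < 1" "0 < x" "0 < y" for x y :: real
  proof (rule ccontr)
    assume "\<not> 1 < y"
    then have "x * y \<le> x * 1" using that(3) by (intro mult_left_mono) linarith+
    then show False using that by linarith
  qed
  \<comment> \<open>A small \<open>a i\<close> makes \<open>b (i - 1)\<close> large, so by
    \<open>bad\<close> the other partner of the latter at distance 3, \<open>a (i - 3)\<close>, is
    small. Modulo 7 this is a shift by 4, and two of these make a shift by 1.\<close>
  have step: "a (i + 4) < 1" if "a i < 1" for i
  proof -
    have *: "1 \<le> a (i + 7) * b (i + 6)"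
      using ba3[of "i + 6"] by (simp only: index_shift mult.commute)
    have "1 < b (i + 6)" using gt[OF *] that per pos by simp
    then show ?thesis using bad[of "i + 4"] by (simp only: index_shift not_less[symmetric]) simp
  qed
  show False
  proof (cases "\<exists>i. a i < 1")
    case True
    then obtain i where i: "a i < 1" by auto
    have 1: "a (i + 1) < 1"
      using step[OF step[OF i]] per(1)[of "i + 1"] by (simp only: index_shift)
    have 2: "a (i + 2) < 1"
      using step[OF step[OF 1]] per(1)[of "i + 2"] by (simp only: index_shift)
    \<comment> \<open>Both neighbours of \<open>b (i + 2)\<close> are small, so it is at most 1,
      while its partner \<open>a i\<close> at distance 3 forces it above 1.\<close>
    have "b (i + 2) \<le> a (i + 1) * a (i + 2)" using ba[of "i + 1"] by (simp only: index_shift)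
    also have "\<dots> \<le> 1" using 1 2 pos by (intro mult_le_one) (auto intro: less_imp_le)
    finally show False using gt[OF ab3[of i]] i pos by (simp add: not_less[symmetric])
  next
    case False
    then have b1: "b i < 1" for i
      using bad[of "i + 5"] per(2)[of i] by (simp only: index_shift) auto
    have "b 0 * b 1 \<le> b 0 * 1" using b1 pos by (intro mult_left_mono) (auto intro: less_imp_le)
    then have "a 0 < 1" using ab[of 0] b1[of 0] by simp
    then show False using False by blast
  qed
qed

text \<open>The sums do not change when \<open>t\<close> moves from the upper to the lower terms.
  The least \<open>x\<close> is the largest shift that keeps the upper terms nonnegative, and with
  it each lower term becomes one of the nine sums.\<close>

lemma nonneg_split:
  fixes x1 :: real
  assumes "0 \<le> x1 + y1" "0 \<le> x1 + y2" "0 \<le> x1 + y3"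
    "0 \<le> x2 + y1" "0 \<le> x2 + y2" "0 \<le> x2 + y3"
    "0 \<le> x3 + y1" "0 \<le> x3 + y2" "0 \<le> x3 + y3"
  defines "t \<equiv> min x1 (min x2 x3)"
  shows "0 \<le> x1 - t" "0 \<le> x2 - t" "0 \<le> x3 - t" "0 \<le> y1 + t" "0 \<le> y2 + t" "0 \<le> y3 + t"
  using assms by auto

text \<open>With \<open>f0\<close>, ..., \<open>f6\<close> the values at the vertices
  \<open>r\<close>, ..., \<open>r + 6\<close>, the left sides are multiples of the two sums of an
  upper and a lower vertex that are not vertices of the heptagon. The coefficients on the right are
  those that the frieze inequalities and the choice of \<open>r\<close> make nonnegative.\<close>

lemma frieze_identities:
  fixes a0 :: real
  shows "f3 = a0 * f2 - b0 * f1 + f0 \<Longrightarrow> f4 = a1 * f3 - b1 * f2 + f1 \<Longrightarrow>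
      a1 * (b0 * f1 + (f4 - f0)) = (a1 - 1) * f4 + (a0 * a1 - b1) * f2 + f1"
    and "f3 = a0 * f2 - b0 * f1 + f0 \<Longrightarrow> f6 = a3 * f5 - b3 * f4 + f3 \<Longrightarrow> f0 = a4 * f6 - b4 * f5 + f4 \<Longrightarrow>
      b3 * (a4 * f6 + (a0 * f2 - b0 * f1)) = (b3 - 1) * f3 + (b3 * b4 - a3) * f5 + f6"
proof -
  assume f3: "f3 = a0 * f2 - b0 * f1 + f0" and f4: "f4 = a1 * f3 - b1 * f2 + f1"
  have "a1 * (b0 * f1 + (f4 - f0)) = a1 * f4 - a1 * f3 + a1 * a0 * f2"
    unfolding f3 by (simp add: algebra_simps)
  also have "\<dots> = (a1 - 1) * f4 + (a0 * a1 - b1) * f2 + f1"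
    using f4 by (simp add: algebra_simps)
  finally show "a1 * (b0 * f1 + (f4 - f0)) = (a1 - 1) * f4 + (a0 * a1 - b1) * f2 + f1" .
next
  assume f3: "f3 = a0 * f2 - b0 * f1 + f0" and f6: "f6 = a3 * f5 - b3 * f4 + f3"
    and f0: "f0 = a4 * f6 - b4 * f5 + f4"
  have "a4 * f6 + (a0 * f2 - b0 * f1) = f3 + b4 * f5 - f4"
    using f0 f3 by linarith
  then have "b3 * (a4 * f6 + (a0 * f2 - b0 * f1)) = b3 * (f3 + b4 * f5 - f4)" by (rule arg_cong)
  also have "\<dots> = (b3 - 1) * f3 + (b3 * b4 - a3) * f5 + f6"
    using f6 by (simp add: algebra_simps)
  finally show "b3 * (a4 * f6 + (a0 * f2 - b0 * f1)) = (b3 - 1) * f3 + (b3 * b4 - a3) * f5 + f6" .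
qed

text \<open>Row \<open>l\<close> evaluates one linear functional at the seven vertices, scaled so
  that the recurrence holds. The shift \<open>t\<close> depends nonlinearly on the row, so it can
  leave the column space: it is the extra dimension of the polytope.\<close>

lemma frieze_factor:
  fixes a b :: "nat \<Rightarrow> real" and f :: "nat \<Rightarrow> nat \<Rightarrow> real"
  assumes pos: "\<And>i. 0 < a i" "\<And>i. 0 < b i"
    and ba: "\<And>i. b (i + 1) \<le> a i * a (i + 1)"
    and ab: "\<And>i. a i \<le> b i * b (i + 1)"
    and per: "\<And>l i. f l (i + 7) = f l i"
    and nn: "\<And>l i. l < m \<Longrightarrow> 0 \<le> f l i"
    and rec: "\<And>l i. l < m \<Longrightarrow> f l (i + 3) = a i * f l (i + 2) - b i * f l (i + 1) + f l i"
    and r: "1 \<le> a (r + 1)" "1 \<le> b (r + 3)"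
  shows "\<exists>B. (\<forall>l<m. \<forall>t<6. 0 \<le> B l t) \<and> (\<forall>s<7. conic_comb m 6 B (\<lambda>l. f l (r + s)))"
proof -
  \<comment> \<open>\<open>x1, x2, x3\<close> are the upper and \<open>y1 = 0, y2, y3\<close> the lower vertices of the polytope.\<close>
  define x1 where "x1 l = b r * f l (r + 1)" for l
  define x2 where "x2 l = f l r" for l
  define x3 where "x3 l = a (r + 4) * f l (r + 6)" for l
  define y2 where "y2 l = a r * f l (r + 2) - x1 l" for l
  define y3 where "y3 l = f l (r + 4) - x2 l" for l
  define t where "t l = min (x1 l) (min (x2 l) (x3 l))" for l
  define B where "B l k = [x1 l - t l, x2 l - t l, x3 l - t l, 0 + t l, y2 l + t l, y3 l + t l] ! k" for l k
  \<comment> \<open>The recurrence at \<open>r\<close> and at \<open>r + 4\<close>, where the index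
    \<open>r + 7\<close> wraps around to \<open>r\<close>. The other five vertices are sums of an
    upper and a lower vertex by definition.\<close>
  have e: "f l (r + 3) = x2 l + y2 l" "b (r + 4) * f l (r + 5) = x3 l + y3 l" if "l < m" for l
    using rec[OF that, of r] rec[OF that, of "r + 4"] per[of l r]
    by (simp_all only: x1_def x2_def x3_def y2_def y3_def index_shift)
  have B: "0 \<le> x1 l - t l" "0 \<le> x2 l - t l" "0 \<le> x3 l - t l" "0 \<le> 0 + t l" "0 \<le> y2 l + t l" "0 \<le> y3 l + t l"
    if l: "l < m" for l
  proof -
    have cancel: "0 \<le> z" if "0 \<le> c * z" "0 < c" for c z :: real
      using that by (simp add: zero_le_mult_iff)
    have rec0: "f l (r + 3) = a r * f l (r + 2) - b r * f l (r + 1) + f l r"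
      and rec1: "f l (r + 4) = a (r + 1) * f l (r + 3) - b (r + 1) * f l (r + 2) + f l (r + 1)"
      and rec3: "f l (r + 6) = a (r + 3) * f l (r + 5) - b (r + 3) * f l (r + 4) + f l (r + 3)"
      and rec4: "f l r = a (r + 4) * f l (r + 6) - b (r + 4) * f l (r + 5) + f l (r + 4)"
      using rec[OF l, of r] rec[OF l, of "r + 1"] rec[OF l, of "r + 3"] rec[OF l, of "r + 4"] per[of l r]
      by (simp_all only: index_shift)
    \<comment> \<open>The two sums that are not vertices are the ones for which \<open>r\<close> was
      chosen.\<close>
    have "a (r + 1) * (x1 l + y3 l) = (a (r + 1) - 1) * f l (r + 4) +
        (a r * a (r + 1) - b (r + 1)) * f l (r + 2) + f l (r + 1)"
      unfolding x1_def y3_def x2_def by (rule frieze_identities(1)[OF rec0 rec1])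
    also have "0 \<le> \<dots>"
      using r ba[of r] nn[OF l] by (intro add_nonneg_nonneg mult_nonneg_nonneg) auto
    finally have 1: "0 \<le> x1 l + y3 l" using pos(1) by (rule cancel)
    have "b (r + 3) * (x3 l + y2 l) = (b (r + 3) - 1) * f l (r + 3) +
        (b (r + 3) * b (r + 4) - a (r + 3)) * f l (r + 5) + f l (r + 6)"
      unfolding x1_def y2_def x3_def by (rule frieze_identities(2)[OF rec0 rec3 rec4])
    also have "0 \<le> \<dots>"
      using r ab[of "r + 3"] nn[OF l]
      by (intro add_nonneg_nonneg mult_nonneg_nonneg) (auto simp only: index_shift diff_ge_0_iff_ge)
    finally have 2: "0 \<le> x3 l + y2 l" using pos(2) by (rule cancel)
    have "0 \<le> x1 l" "0 \<le> x2 l" "0 \<le> x3 l" "0 \<le> x1 l + y2 l" "0 \<le> x2 l + y3 l"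
      using nn[OF l] pos[THEN less_imp_le] by (simp_all add: x1_def x2_def x3_def y2_def y3_def)
    moreover have "0 \<le> x2 l + y2 l" "0 \<le> x3 l + y3 l"
      using e[OF l, symmetric] nn[OF l] pos[THEN less_imp_le] by simp_all
    ultimately show "0 \<le> x1 l - t l" "0 \<le> x2 l - t l" "0 \<le> x3 l - t l" "0 \<le> 0 + t l" "0 \<le> y2 l + t l" "0 \<le> y3 l + t l"
      using nonneg_split[of "x1 l" 0 "y2 l" "y3 l" "x2 l" "x3 l"] 1 2 unfolding t_def by auto
  qed
  have comb: "conic_comb m 6 B (\<lambda>l. f l (r + s))"
    if "i < 6" "j < 6" "i \<noteq> j" "0 < c" "\<And>l. l < m \<Longrightarrow> c * f l (r + s) = B l i + B l j" for s i j c
  proof (rule conic_comb_pair[of i 6 j "1 / c"])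
    show "f l (r + s) = 1 / c * (B l i + B l j)" if "l < m" for l
      using that \<open>0 < c\<close> \<open>\<And>l. l < m \<Longrightarrow> c * f l (r + s) = B l i + B l j\<close>[OF that] by (simp add: field_simps)
  qed (use that in auto)
  have "conic_comb m 6 B (\<lambda>l. f l (r + s))" if "s < 7" for s
  proof -
    consider "s = 0" | "s = 1" | "s = 2" | "s = 3" | "s = 4" | "s = 5" | "s = 6"
      using \<open>s < 7\<close> by linarith
    then show ?thesis
    proof cases
      case 1 then show ?thesis by (intro comb[of 1 3 1]) (auto simp: B_def x2_def)
    next
      case 2 then show ?thesis using pos by (intro comb[of 0 3 "b r"]) (auto simp: B_def x1_def)
    next
      case 3 then show ?thesis using pos by (intro comb[of 0 4 "a r"]) (auto simp: B_def y2_def)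
    next
      case 4 then show ?thesis using e by (intro comb[of 1 4 1]) (auto simp: B_def)
    next
      case 5 then show ?thesis by (intro comb[of 1 5 1]) (auto simp: B_def y3_def)
    next
      case 6 then show ?thesis using e pos by (intro comb[of 2 5 "b (r + 4)"]) (auto simp: B_def)
    next
      case 7 then show ?thesis using pos by (intro comb[of 2 3 "a (r + 4)"]) (auto simp: B_def x3_def)
    qed
  qed
  moreover have "0 \<le> B l k" if "l < m" "k < 6" for l k
  proof -
    consider "k = 0" | "k = 1" | "k = 2" | "k = 3" | "k = 4" | "k = 5"
      using \<open>k < 6\<close> by linarith
    then show ?thesis using B[OF \<open>l < m\<close>] by cases (simp_all add: B_def)
  qed
  ultimately show ?thesis by blast
qed

lemma conic_comb_scale:
  assumes "conic_comb m k B v" "0 \<le> x" "\<And>i. i < m \<Longrightarrow> w i = x * v i"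
  shows "conic_comb m k B w"
proof -
  obtain c where c: "\<forall>t<k. 0 \<le> c t" "\<forall>i<m. v i = (\<Sum>t<k. B i t * c t)"
    using assms(1) unfolding conic_comb_def by auto
  then show ?thesis unfolding conic_comb_def
    using assms(2,3) by (intro exI[of _ "\<lambda>t. x * c t"]) (auto simp: sum_distrib_left mult_ac)
qed

text \<open>A sorted list of the other elements is partitioned around the new one. The order is a
  relation on a set because it will be the angular order around a vertex, which is an order only on
  the polygon at hand.\<close>

lemma ex_sorted_wrt_list:
  assumes "finite S"
    and "\<And>x y. x \<in> S \<Longrightarrow> y \<in> S \<Longrightarrow> x \<noteq> y \<Longrightarrow> R x y \<or> R y x"
    and "\<And>x y z. x \<in> S \<Longrightarrow> y \<in> S \<Longrightarrow> z \<in> S \<Longrightarrow> R x y \<Longrightarrow> R y z \<Longrightarrow> R x z"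
  shows "\<exists>xs. distinct xs \<and> set xs = S \<and> sorted_wrt R xs"
  using assms
proof (induction S rule: finite_induct)
  case empty
  show ?case by simp
next
  case (insert x S)
  have "\<exists>xs. distinct xs \<and> set xs = S \<and> sorted_wrt R xs"
  proof (rule insert.IH)
    show "R y z \<or> R z y" if "y \<in> S" "z \<in> S" "y \<noteq> z" for y z
      using insert.prems(1)[of y z] that by simp
    show "R u z" if "u \<in> S" "y \<in> S" "z \<in> S" "R u y" "R y z" for u y z
      using insert.prems(2)[of u y z] that by simp
  qed
  then obtain xs where xs: "distinct xs" "set xs = S" "sorted_wrt R xs" by blast
  let ?ys = "filter (\<lambda>y. R y x) xs @ x # filter (\<lambda>y. \<not> R y x) xs"
  have gt: "R x z" if "z \<in> S" "\<not> R z x" for z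
    using insert.prems(1)[of x z] insert.hyps(2) that by auto
  moreover have "R y z" if "y \<in> S" "R y x" "z \<in> S" "\<not> R z x" for y z
    using insert.prems(2)[of y x z] gt that by auto
  ultimately have "sorted_wrt R ?ys"
    using xs by (auto simp: sorted_wrt_append sorted_wrt_filter)
  moreover have "distinct ?ys" "set ?ys = insert x S"
    using xs insert.hyps(2) by auto
  ultimately show ?case by blast
qed

section \<open>Orientation of triples of vectors in 3-space\<close>

definition det3 :: "(nat \<Rightarrow> real) \<Rightarrow> (nat \<Rightarrow> real) \<Rightarrow> (nat \<Rightarrow> real) \<Rightarrow> real" where
  "det3 u v w = u 0 * (v 1 * w 2 - v 2 * w 1) - u 1 * (v 0 * w 2 - v 2 * w 0)
     + u 2 * (v 0 * w 1 - v 1 * w 0)"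

lemma less_3_cases: "(t::nat) < 3 \<Longrightarrow> (t = 0 \<Longrightarrow> P) \<Longrightarrow> (t = 1 \<Longrightarrow> P) \<Longrightarrow> (t = 2 \<Longrightarrow> P) \<Longrightarrow> P"
  by linarith

lemma det3_rotate: "det3 u v w = det3 v w u"
  by (simp add: det3_def algebra_simps)

lemma det3_swap: "det3 u w v = - det3 u v w"
  by (simp add: det3_def algebra_simps)

lemma det3_same: "det3 u v v = 0"
  by (simp add: det3_def algebra_simps)

lemma det3_scale: "det3 (\<lambda>t. x * u t) (\<lambda>t. y * v t) (\<lambda>t. z * w t) = x * y * z * det3 u v w"
  by (simp add: det3_def algebra_simps)

lemma det3_combination:
  assumes "\<And>t. t < 3 \<Longrightarrow> w t = x * w1 t - y * w2 t + w3 t"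
  shows "det3 u v w = x * det3 u v w1 - y * det3 u v w2 + det3 u v w3"
proof -
  have e: "w 0 = x * w1 0 - y * w2 0 + w3 0" "w 1 = x * w1 1 - y * w2 1 + w3 1" "w 2 = x * w1 2 - y * w2 2 + w3 2"
    using assms by simp_all
  show ?thesis unfolding det3_def e by (simp add: algebra_simps)
qed

text \<open>Cramer's rule for four vectors in 3-space. It is the source of the frieze recurrence and
  of the relations between four columns.\<close>

lemma det3_four_vectors:
  assumes "t < 3"
  shows "det3 v w x * u t - det3 u w x * v t + det3 u v x * w t - det3 u v w * x t = 0"
  by (rule less_3_cases[OF assms]) (simp_all add: det3_def algebra_simps)

text \<open>The left side is the determinant of the coordinate rows \<open>s\<close>,
  \<open>t\<close>, \<open>q\<close>, expanded along row \<open>q\<close>. It vanishes by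
  assumption, or because a row repeats. A nonzero minor thus yields a linear dependence with a known
  nonzero coefficient.\<close>

lemma det3_zero_relation:
  assumes "det3 u v w = 0" "s < 3" "t < 3" "q < 3"
  shows "(v s * w t - v t * w s) * u q - (u s * w t - u t * w s) * v q + (u s * v t - u t * v s) * w q = 0"
  by (rule less_3_cases[OF assms(2)]; rule less_3_cases[OF assms(3)]; rule less_3_cases[OF assms(4)];
      use assms(1) in \<open>simp add: det3_def algebra_simps\<close>)

text \<open>Positive orientation of every cyclically ordered triple is convex position.\<close>

lemma convex_heptagon_factor:
  fixes p :: "nat \<Rightarrow> nat \<Rightarrow> real" and F :: "nat \<Rightarrow> nat \<Rightarrow> real"
  assumes per: "\<And>i. p (i + 7) = p i"
    and det: "\<And>i s t. 0 < s \<Longrightarrow> s < t \<Longrightarrow> t < 7 \<Longrightarrow> 0 < det3 (p i) (p (i + s)) (p (i + t))"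
    and nn: "\<And>l i. l < m \<Longrightarrow> 0 \<le> (\<Sum>t<3. F l t * p i t)"
  shows "\<exists>r B. (\<forall>l<m. \<forall>t<6. 0 \<le> B l t) \<and>
    (\<forall>s<7. conic_comb m 6 B (\<lambda>l. \<Sum>t<3. F l t * p (r + s) t))"
proof -
  define C where "C i = det3 (p i) (p (i + 1)) (p (i + 2))" for i
  have Cpos: "0 < C i" for i using det[of 1 2 i] by (simp add: C_def)
  have Cper: "C (i + 7) = C i" for i
    using per[of i] per[of "i + 1"] per[of "i + 2"] by (simp add: C_def add.assoc add.commute[of 7])
  define Q where "Q i = (\<Prod>k<7. C (i + k))" for i
  have "Q (Suc i) = Q i" for i
  proof -
    have "Q (Suc i) * C i = (\<Prod>k<Suc 7. C (i + k))"
      unfolding Q_def prod.lessThan_Suc_shift[of _ 7] by simp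
    also have "\<dots> = Q i * C (i + 7)" unfolding Q_def prod.lessThan_Suc ..
    finally show ?thesis using Cper[of i] Cpos[of i] by simp
  qed
  then have Qconst: "Q i = Q 0" for i by (induction i) auto
  have Qpos: "0 < Q 0" unfolding Q_def by (intro prod_pos) (simp add: Cpos)
  define P where "P = root 3 (1 / Q 0)"
  have P3: "P ^ 3 = 1 / Q 0" and Ppos: "0 < P"
    using Qpos by (simp_all add: P_def real_root_pow_pos2)
  \<comment> \<open>The scaling has to solve
    \<open>lam i * lam (i + 1) * lam (i + 2) * C i = 1\<close>. Shifting \<open>i + 1\<close> and
    \<open>i + 4\<close> by 0, 1, 2 hits each of \<open>i + 1\<close> to \<open>i + 6\<close> once,
    so the left side is \<open>P ^ 3\<close> times the product \<open>Q\<close> over a full period,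
    which is constant.\<close>
  define lam where "lam i = P * C (i + 1) * C (i + 4)" for i
  have lampos: "0 < lam i" for i using Ppos Cpos by (simp add: lam_def)
  define q where "q i = (\<lambda>t. lam i * p i t)" for i
  have qper: "q (i + 7) = q i" for i
    using Cper[of "i + 1"] Cper[of "i + 4"] per[of i]
    by (simp add: q_def lam_def add.assoc add.commute[of 7])
  have qdet: "0 < det3 (q i) (q (i + s)) (q (i + t))" if "0 < s" "s < t" "t < 7" for i s t
    unfolding q_def det3_scale using det[OF that] lampos by simp
  have q1: "det3 (q i) (q (i + 1)) (q (i + 2)) = 1" for i
  proof -
    have "det3 (q i) (q (i + 1)) (q (i + 2)) = lam i * lam (i + 1) * lam (i + 2) * C i"
      unfolding q_def det3_scale C_def ..
    also have "\<dots> = P ^ 3 * Q i"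
      by (simp add: lam_def Q_def eval_nat_numeral mult_ac)
    finally show ?thesis using P3 Qconst[of i] Qpos by simp
  qed
  \<comment> \<open>Once consecutive triples have determinant 1, Cramer's rule writes
    \<open>q (i + 3)\<close> through its three predecessors with these minors as
    coefficients.\<close>
  define a where "a i = det3 (q i) (q (i + 1)) (q (i + 3))" for i
  define b where "b i = det3 (q i) (q (i + 2)) (q (i + 3))" for i
  have rec: "q (i + 3) t = a i * q (i + 2) t - b i * q (i + 1) t + q i t" if "t < 3" for i t
    using det3_four_vectors[OF that, of "q (i + 1)" "q (i + 2)" "q (i + 3)" "q i"] q1[of i] q1[of "i + 1"]
    by (simp only: a_def b_def index_shift)
  \<comment> \<open>The frieze rule: the gap in each of the two inequalities is again the
    determinant of a cyclically ordered triple, hence positive.\<close>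
  have ba': "a i * a (i + 1) - b (i + 1) = det3 (q i) (q (i + 1)) (q (i + 4))" for i
    using det3_combination[of "q (i + 4)" "a (i + 1)" "q (i + 3)" "b (i + 1)" "q (i + 2)" "q (i + 1)" "q i" "q (i + 1)"]
      rec[of _ "i + 1"] q1[of i]
    by (simp only: index_shift det3_same) (simp add: a_def mult.commute)
  have ba: "b (i + 1) \<le> a i * a (i + 1)" for i
  proof -
    have "0 < det3 (q i) (q (i + 1)) (q (i + 4))" by (rule qdet) auto
    then show ?thesis using ba'[of i] by linarith
  qed
  have ab': "b i * b (i + 1) - a i = det3 (q i) (q (i + 3)) (q (i + 4))" for i
  proof -
    have "det3 (q (i + 3)) (q (i + 4)) (q i) =
        b i * det3 (q (i + 3)) (q (i + 4)) (q (i + 1)) - a i * det3 (q (i + 3)) (q (i + 4)) (q (i + 2))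
        + det3 (q (i + 3)) (q (i + 4)) (q (i + 3))"
      using rec[of _ i] by (intro det3_combination) simp
    moreover have "det3 (q (i + 3)) (q (i + 4)) (q (i + 3)) = 0"
      by (metis det3_rotate det3_same)
    moreover have "det3 (q (i + 3)) (q (i + 4)) (q (i + 2)) = 1"
      using q1[of "i + 2"] det3_rotate by (simp only: index_shift) metis
    moreover have "det3 (q (i + 3)) (q (i + 4)) (q (i + 1)) = b (i + 1)"
      unfolding b_def by (simp only: index_shift) (metis det3_rotate)
    ultimately show ?thesis using det3_rotate[of "q i"] by simp
  qed
  have ab: "a i \<le> b i * b (i + 1)" for i
  proof -
    have "0 < det3 (q i) (q (i + 3)) (q (i + 4))" by (rule qdet) auto
    then show ?thesis using ab'[of i] by linarith
  qed
  have pos: "0 < a i" "0 < b i" for i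
    using qdet[of 1 3 i] qdet[of 2 3 i] by (simp_all add: a_def b_def)
  have aper: "a (i + 7) = a i" and bper: "b (i + 7) = b i" for i
    using qper[of i] qper[of "i + 1"] qper[of "i + 2"] qper[of "i + 3"]
    by (simp_all add: a_def b_def add.assoc add.commute[of 7])
  obtain r where r: "1 \<le> a (r + 1)" "1 \<le> b (r + 3)"
    using frieze_step[OF aper bper pos ba ab] by blast
  define f where "f l i = (\<Sum>t<3. F l t * q i t)" for l i
  have f: "f l i = lam i * (\<Sum>t<3. F l t * p i t)" for l i
    by (simp add: f_def q_def sum_distrib_left mult_ac)
  have frec: "f l (i + 3) = a i * f l (i + 2) - b i * f l (i + 1) + f l i" for l i
    unfolding f_def sum_distrib_left sum_subtractf[symmetric] sum.distrib[symmetric]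
    by (intro sum.cong refl) (simp add: rec algebra_simps)
  have fper: "f l (i + 7) = f l i" for l i
    unfolding f_def qper ..
  have fnn: "0 \<le> f l i" if "l < m" for l i
    unfolding f using nn[OF that] lampos[of i] by simp
  obtain B where "\<forall>l<m. \<forall>t<6. 0 \<le> B l t" "\<forall>s<7. conic_comb m 6 B (\<lambda>l. f l (r + s))"
    using frieze_factor[where f = f and m = m, OF pos ba ab fper fnn frec r] by blast
  moreover have "conic_comb m 6 B (\<lambda>l. \<Sum>t<3. F l t * p i t)" if "conic_comb m 6 B (\<lambda>l. f l i)" for i
    using lampos[of i] by (intro conic_comb_scale[OF that, of "1 / lam i"]) (auto simp: f)
  ultimately show ?thesis by blast
qed

text \<open>If there is no such factorization, then no column lies in the cone of three others,
  since it could be dropped. This already makes any three of the vectors \<open>V j\<close>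
  independent and puts the seven rays in convex position, so that
  \<open>convex_heptagon_factor\<close> applies.\<close>

lemma seven_columns_factor:
  fixes A F V :: "nat \<Rightarrow> nat \<Rightarrow> real"
  assumes A: "\<And>l j. l < m \<Longrightarrow> j < 7 \<Longrightarrow> A l j = (\<Sum>t<3. F l t * V j t)"
    and nn: "\<And>l j. l < m \<Longrightarrow> j < 7 \<Longrightarrow> 0 \<le> A l j"
  shows "nonneg_factor m 7 6 A"
proof (rule ccontr)
  assume neg: "\<not> ?thesis"
  have no: False if "j < 7" "i < 7" "k < 7" "l < 7" "i \<noteq> j" "k \<noteq> j" "l \<noteq> j"
      "0 < w" "0 \<le> x" "0 \<le> y" "0 \<le> z"
      "\<And>r. r < m \<Longrightarrow> w * A r j = x * A r i + y * A r k + z * A r l" for i j k l w x y z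
  proof -
    have "nonneg_factor m 7 (7 - 1) A"
    proof (rule nonneg_factor_redundant_column[where j = j and i = i and k = k and l = l
          and x = "x / w" and y = "y / w" and z = "z / w"])
      show "A r j = x / w * A r i + y / w * A r k + z / w * A r l" if "r < m" for r
        using \<open>0 < w\<close> \<open>\<And>r. r < m \<Longrightarrow> w * A r j = x * A r i + y * A r k + z * A r l\<close>[OF that]
        by (simp add: field_simps)
    qed (use that nn in auto)
    with neg show False by simp
  qed
  have rel: "x * A r i + y * A r j + z * A r k + w * A r l = 0"
    if "r < m" "i < 7" "j < 7" "k < 7" "l < 7"
      "\<And>t. t < 3 \<Longrightarrow> x * V i t + y * V j t + z * V k t + w * V l t = 0" for r i j k l x y z w
  proof -
    have "x * A r i + y * A r j + z * A r k + w * A r l =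
        (\<Sum>t<3. F r t * (x * V i t + y * V j t + z * V k t + w * V l t))"
      using that(1-5) by (simp add: A sum.distrib sum_distrib_left distrib_left mult_ac)
    then show ?thesis using that(6) by simp
  qed
  \<comment> \<open>The column sums are a linear functional that is positive on every column,
    because a zero column would be redundant. It excludes nontrivial relations whose coefficients
    all have the same sign.\<close>
  define h where "h j = (\<Sum>r<m. A r j)" for j
  have h: "0 < h j" if j: "j < 7" for j
  proof (rule ccontr)
    assume "\<not> 0 < h j"
    moreover have "0 \<le> h j" unfolding h_def using nn j by (intro sum_nonneg) auto
    ultimately have "h j = 0" by simp
    then have "A r j = 0" if "r < m" for r
      using that nn j unfolding h_def by (subst (asm) sum_nonneg_eq_0_iff) auto
    then show False using j
      by (intro no[of j "if j = 0 then 1 else 0" "if j = 0 then 1 else 0" "if j = 0 then 1 else 0" 1 0 0 0]) auto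
  qed
  \<comment> \<open>The functional \<open>h\<close> rules out that all coefficients are nonnegative;
    any other sign pattern puts one column in the cone of the other two.\<close>
  have three: False
    if d: "i < 7" "j < 7" "k < 7" "i \<noteq> j" "i \<noteq> k" "j \<noteq> k"
      and z: "0 < z" and eq: "\<And>r. r < m \<Longrightarrow> x * A r i + y * A r j + z * A r k = 0"
    for i j k x y z
  proof -
    have "x * h i + y * h j + z * h k = (\<Sum>r<m. x * A r i + y * A r j + z * A r k)"
      by (simp add: h_def sum.distrib sum_distrib_left)
    also have "\<dots> = 0" using eq by simp
    finally have hs: "x * h i + y * h j + z * h k = 0" .
    consider "0 \<le> x" "0 \<le> y" | "x < 0" "0 \<le> y" | "0 \<le> x" "y < 0" | "x < 0" "y < 0" by linarith
    then show False
    proof cases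
      case 1
      then have "0 \<le> x * h i" "0 \<le> y * h j" "0 < z * h k"
        using h d z by (auto intro: mult_nonneg_nonneg less_imp_le)
      with hs show False by linarith
    next
      case 2
      show False
        using no[of i j k k "- x" y z 0] eq d z 2 by (simp add: algebra_simps) (smt (verit))
    next
      case 3
      show False
        using no[of j i k k "- y" x z 0] eq d z 3 by (simp add: algebra_simps) (smt (verit))
    next
      case 4
      show False
        using no[of k i j j z "- x" "- y" 0] eq d z 4 by (simp add: algebra_simps) (smt (verit))
    qed
  qed
  have three': "z = 0"
    if d: "i < 7" "j < 7" "k < 7" "i \<noteq> j" "i \<noteq> k" "j \<noteq> k"
      and eq: "\<And>t. t < 3 \<Longrightarrow> x * V i t + y * V j t + z * V k t = 0"
    for i j k x y z
  proof (rule ccontr)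
    assume "z \<noteq> 0"
    have 1: "x * A r i + y * A r j + z * A r k = 0" if "r < m" for r
      using rel[of r i j k k x y z 0] that d eq by simp
    then have 2: "(- x) * A r i + (- y) * A r j + (- z) * A r k = 0" if "r < m" for r
      using 1[OF that] by simp
    show False
    proof (cases "0 < z")
      case True
      show False by (rule three[OF d True 1])
    next
      case False
      then have "0 < - z" using \<open>z \<noteq> 0\<close> by simp
      then show False by (rule three[OF d _ 2])
    qed
  qed
  have indep2: "\<exists>s<3. \<exists>t<3. V i s * V j t - V i t * V j s \<noteq> 0"
    if d: "i < 7" "j < 7" "i \<noteq> j" for i j
  proof (rule ccontr)
    assume "\<not> ?thesis"
    then have eq: "V i s * V j t = V i t * V j s" if "s < 3" "t < 3" for s t
      using that by auto
    have hV: "h k = (\<Sum>t<3. (\<Sum>r<m. F r t) * V k t)" if "k < 7" for k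
      unfolding h_def using A that by (simp add: sum.swap[of _ "{..<m}"] sum_distrib_right)
    have "h j * V i s = h i * V j s" if "s < 3" for s
      unfolding hV[OF d(1)] hV[OF d(2)] sum_distrib_right using eq[OF that] by (intro sum.cong refl)
        (simp add: mult_ac)
    then have "h i * A r j = h j * A r i" if "r < m" for r
      using rel[OF that, of i j j j "h j" "- h i" 0 0] d by simp
    then show False using no[of j i i i "h i" "h j" 0 0] h d by (auto intro: less_imp_le)
  qed
  have det_nz: "det3 (V i) (V j) (V k) \<noteq> 0"
    if d: "i < 7" "j < 7" "k < 7" "i \<noteq> j" "i \<noteq> k" "j \<noteq> k" for i j k
  proof
    assume 0: "det3 (V i) (V j) (V k) = 0"
    obtain s t where st: "s < 3" "t < 3" "V i s * V j t - V i t * V j s \<noteq> 0"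
      using indep2[of i j] d by blast
    have "(V j s * V k t - V j t * V k s) * V i q + - (V i s * V k t - V i t * V k s) * V j q
        + (V i s * V j t - V i t * V j s) * V k q = 0" if "q < 3" for q
      using det3_zero_relation[OF 0 st(1,2) that] by (simp only: mult_minus_left add_uminus_conv_diff)
    from three'[OF d this] st(3) show False by blast
  qed
  have four: "det3 (V j) (V k) (V l) * A r i - det3 (V i) (V k) (V l) * A r j
      + det3 (V i) (V j) (V l) * A r k - det3 (V i) (V j) (V k) * A r l = 0"
    if "r < m" "i < 7" "j < 7" "k < 7" "l < 7" for r i j k l
    using rel[OF that, of "det3 (V j) (V k) (V l)" "- det3 (V i) (V k) (V l)" "det3 (V i) (V j) (V l)" "- det3 (V i) (V j) (V k)"]
      det3_four_vectors[of _ "V j" "V k" "V l" "V i"] by simp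
  \<comment> \<open>The order in which the other vertices are seen from vertex 0.\<close>
  define R where "R j k \<longleftrightarrow> 0 < det3 (V 0) (V j) (V k)" for j k
  have total: "R j k \<or> R k j" if "j \<in> {1..6}" "k \<in> {1..6}" "j \<noteq> k" for j k
    using det_nz[of 0 j k] det3_swap[of "V 0" "V j" "V k"] that by (auto simp: R_def)
  have trans: "R j l" if "j \<in> {1..6}" "k \<in> {1..6}" "l \<in> {1..6}" and R: "R j k" "R k l" for j k l
  proof (rule ccontr)
    assume nR: "\<not> R j l"
    have ne: "j \<noteq> k" "k \<noteq> l" using R by (auto simp: R_def det3_same)
    have "j \<noteq> l" using R det3_swap[of "V 0" "V j" "V k"] by (auto simp: R_def)
    then have neg: "det3 (V 0) (V j) (V l) < 0"
      using nR det_nz[of 0 j l] that(1,3) by (auto simp: R_def not_less)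
    \<comment> \<open>The relation between the columns 0, \<open>j\<close>, \<open>k\<close>,
      \<open>l\<close> either puts column 0 in the cone of the other three or has only nonpositive
      coefficients, against \<open>h\<close>.\<close>
    show False
    proof (cases "0 < det3 (V j) (V k) (V l)")
      case True
      show False
        using no[of 0 j k l "det3 (V j) (V k) (V l)" "det3 (V 0) (V k) (V l)" "- det3 (V 0) (V j) (V l)"
            "det3 (V 0) (V j) (V k)"] four[of _ 0 j k l] True neg R that(1-3)
        by (simp add: R_def algebra_simps)
    next
      case False
      have "0 = (\<Sum>r<m. det3 (V j) (V k) (V l) * A r 0 - det3 (V 0) (V k) (V l) * A r j
          + det3 (V 0) (V j) (V l) * A r k - det3 (V 0) (V j) (V k) * A r l)"
        using four[of _ 0 j k l] that(1-3) by simp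
      also have "\<dots> = det3 (V j) (V k) (V l) * h 0 - det3 (V 0) (V k) (V l) * h j
          + det3 (V 0) (V j) (V l) * h k - det3 (V 0) (V j) (V k) * h l"
        by (simp add: h_def sum.distrib sum_subtractf sum_distrib_left)
      finally have hs: "0 = \<dots>" .
      have "det3 (V j) (V k) (V l) * h 0 \<le> 0" "0 < det3 (V 0) (V k) (V l) * h j"
        "det3 (V 0) (V j) (V l) * h k < 0" "0 < det3 (V 0) (V j) (V k) * h l"
        using False R neg h[of 0] h[of j] h[of k] h[of l] that(1-3)
        by (auto simp: R_def mult_neg_pos mult_nonpos_nonneg)
      with hs show False by linarith
    qed
  qed
  obtain xs where xs: "distinct xs" "set xs = {1..6}" "sorted_wrt R xs"
    using ex_sorted_wrt_list[of "{1..6}" R] total trans by blast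
  have len: "length xs = 6" using distinct_card[OF xs(1)] xs(2) by simp
  define ys where "ys = 0 # xs"
  have "{..<7::nat} = insert 0 {1..6}"
    by auto
  then have ys: "distinct ys" "set ys = {..<7}" "length ys = 7"
    using xs(1,2) len by (simp_all add: ys_def)
  have ylt: "ys ! i < 7" if "i < 7" for i
    using nth_mem[of i ys] ys that by auto
  have pos0: "0 < det3 (V 0) (V (ys ! j)) (V (ys ! k))" if "0 < j" "j < k" "k < 7" for j k
    using sorted_wrt_nth_less[OF xs(3), of "j - 1" "k - 1"] that len by (simp add: ys_def R_def)
  have pos: "0 < det3 (V (ys ! i)) (V (ys ! j)) (V (ys ! k))" if ijk: "i < j" "j < k" "k < 7" for i j k
  proof (cases "i = 0")
    case True
    then show ?thesis using pos0[of j k] that by (simp add: ys_def)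
  next
    case False
    have "ys ! i \<noteq> ys ! j" "ys ! k \<noteq> ys ! j" "ys ! 0 \<noteq> ys ! j"
      using ijk False ys(3) by (simp_all add: nth_eq_iff_index_eq[OF ys(1)])
    then have d: "ys ! i \<noteq> ys ! j" "ys ! k \<noteq> ys ! j" "0 \<noteq> ys ! j"
      by (simp_all add: ys_def)
    \<comment> \<open>A nonpositive determinant would put the middle column \<open>ys ! j\<close> in
      the cone of column 0 and the columns \<open>ys ! i\<close> and \<open>ys ! k\<close>.\<close>
    show ?thesis
    proof (rule ccontr)
      assume "\<not> ?thesis"
      then show False
        using no[of "ys ! j" 0 "ys ! i" "ys ! k" "det3 (V 0) (V (ys ! i)) (V (ys ! k))"
            "- det3 (V (ys ! i)) (V (ys ! j)) (V (ys ! k))"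
            "det3 (V 0) (V (ys ! j)) (V (ys ! k))" "det3 (V 0) (V (ys ! i)) (V (ys ! j))"]
          four[of _ 0 "ys ! i" "ys ! j" "ys ! k"] ylt d pos0[of i j] pos0[of i k] pos0[of j k] ijk False
        by (simp add: algebra_simps)
    qed
  qed
  define p where "p i = V (ys ! (i mod 7))" for i
  have cyc: "0 < det3 (p i) (p (i + s)) (p (i + t))" if "0 < s" "s < t" "t < 7" for i s t
  proof -
    define i0 where "i0 = i mod 7"
    have i0: "i0 < 7" by (simp add: i0_def)
    have m: "(i + u) mod 7 = (if i0 + u < 7 then i0 + u else i0 + u - 7)" if "u < 7" for u
      using i0 that mod_if[of "i0 + u" 7] unfolding i0_def by (simp add: mod_add_left_eq)
    have s: "s < 7" using that by simp
    show ?thesis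
      unfolding p_def m[OF \<open>t < 7\<close>] m[OF s] i0_def[symmetric]
    proof (cases "i0 + t < 7"; cases "i0 + s < 7")
      assume "i0 + t < 7" "i0 + s < 7"
      then show "0 < det3 (V (ys ! i0)) (V (ys ! (if i0 + s < 7 then i0 + s else i0 + s - 7)))
          (V (ys ! (if i0 + t < 7 then i0 + t else i0 + t - 7)))"
        using pos[of i0 "i0 + s" "i0 + t"] that by simp
    next
      assume "\<not> i0 + t < 7" "i0 + s < 7"
      then show "0 < det3 (V (ys ! i0)) (V (ys ! (if i0 + s < 7 then i0 + s else i0 + s - 7)))
          (V (ys ! (if i0 + t < 7 then i0 + t else i0 + t - 7)))"
        using pos[of "i0 + t - 7" i0 "i0 + s"] that
          det3_rotate[of "V (ys ! (i0 + t - 7))" "V (ys ! i0)" "V (ys ! (i0 + s))"] by simp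
    next
      assume "\<not> i0 + t < 7" "\<not> i0 + s < 7"
      then show "0 < det3 (V (ys ! i0)) (V (ys ! (if i0 + s < 7 then i0 + s else i0 + s - 7)))
          (V (ys ! (if i0 + t < 7 then i0 + t else i0 + t - 7)))"
        using pos[of "i0 + s - 7" "i0 + t - 7" i0] that i0
          det3_rotate[of "V (ys ! i0)" "V (ys ! (i0 + s - 7))" "V (ys ! (i0 + t - 7))"] by simp
    qed (use that in simp)
  qed
  have "0 \<le> (\<Sum>t<3. F l t * p i t)" if "l < m" for l i
    using A[OF that, of "ys ! (i mod 7)"] nn[OF that, of "ys ! (i mod 7)"] ylt[of "i mod 7"]
    by (simp add: p_def)
  then obtain r B where B: "\<forall>l<m. \<forall>t<6. 0 \<le> B l t"
      "\<forall>s<7. conic_comb m 6 B (\<lambda>l. \<Sum>t<3. F l t * p (r + s) t)"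
    using convex_heptagon_factor[of p m F] cyc by (auto simp: p_def)
  have "conic_comb m 6 B (\<lambda>l. A l j)" if j: "j < 7" for j
  proof -
    obtain u where u: "u < 7" "ys ! u = j"
      using j ys by (metis in_set_conv_nth lessThan_iff)
    \<comment> \<open>Modulo 7, \<open>6 * r\<close> is \<open>- r\<close>; this undoes the rotation
      by \<open>r\<close>.\<close>
    define s where "s = (u + 6 * r) mod 7"
    have "(r + s) mod 7 = u"
    proof -
      have "(r + s) mod 7 = (u + r * 7) mod 7"
        unfolding s_def mod_add_right_eq by (simp add: algebra_simps)
      then show ?thesis using u by simp
    qed
    then have eq: "A l j = 1 * (\<Sum>t<3. F l t * p (r + s) t)" if "l < m" for l
      using A[OF that j] u by (simp add: p_def)
    have "s < 7" by (simp add: s_def)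
    with B(2) have "conic_comb m 6 B (\<lambda>l. \<Sum>t<3. F l t * p (r + s) t)" by blast
    then show ?thesis by (rule conic_comb_scale[OF _ zero_le_one eq])
  qed
  with B(1) neg show False unfolding nonneg_factor_def by blast
qed

text \<open>Columns 0 to 6 share six generators and every later column is its own. Column
  \<open>j\<close> becomes generator \<open>j - 1\<close>, and the total is
  \<open>6 + (n - 7)\<close>.\<close>

lemma nonneg_factor_append_columns:
  assumes A: "\<And>i j. i < m \<Longrightarrow> j < n \<Longrightarrow> (0::real) \<le> A i j"
    and "nonneg_factor m 7 6 A" "7 \<le> n"
  shows "nonneg_factor m n (n - 1) A"
proof -
  obtain B where B: "\<forall>i<m. \<forall>t<6. 0 \<le> B i t" "\<forall>j<7. conic_comb m 6 B (\<lambda>i. A i j)"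
    using assms(2) unfolding nonneg_factor_def by blast
  define B' where "B' i t = (if t < 6 then B i t else A i (t + 1))" for i t
  have "0 \<le> B' i t" if "i < m" "t < n - 1" for i t
    using B(1) A that by (simp add: B'_def)
  moreover have "conic_comb m (n - 1) B' (\<lambda>i. A i j)" if j: "j < n" for j
  proof (cases "j < 7")
    case True
    then obtain c where c: "\<forall>t<6. 0 \<le> c t" "\<forall>i<m. A i j = (\<Sum>t<6. B i t * c t)"
      using B(2) unfolding conic_comb_def by blast
    let ?c = "\<lambda>t. if t < 6 then c t else 0"
    have "A i j = (\<Sum>t<n - 1. B' i t * ?c t)" if "i < m" for i
    proof -
      have "A i j = (\<Sum>t<6. B' i t * ?c t)" using c(2) that by (simp add: B'_def)
      also have "\<dots> = (\<Sum>t<n - 1. B' i t * ?c t)"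
        using assms(3) by (intro sum.mono_neutral_left) auto
      finally show ?thesis .
    qed
    then show ?thesis unfolding conic_comb_def using c(1) by (intro exI[of _ ?c]) simp
  next
    case False
    let ?c = "\<lambda>t. if t = j - 1 then 1 else 0"
    have "(\<Sum>t<n - 1. B' i t * ?c t) = B' i (j - 1)" for i
      using False j by (simp add: if_distrib cong: if_cong)
    moreover have "B' i (j - 1) = A i j" for i
    proof -
      have "\<not> j - 1 < 6" "j - 1 + 1 = j" using False by simp_all
      then show ?thesis by (simp add: B'_def del: One_nat_def)
    qed
    ultimately have "A i j = (\<Sum>t<n - 1. B' i t * ?c t)" for i by simp
    then show ?thesis unfolding conic_comb_def by (intro exI[of _ ?c]) simp
  qed
  ultimately show ?thesis unfolding nonneg_factor_def by blast
qed

section \<open>Lower bounds\<close>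

lemma det3_mult:
  fixes S D E :: "nat \<Rightarrow> nat \<Rightarrow> real"
  assumes "\<And>i j. i < 3 \<Longrightarrow> j < 3 \<Longrightarrow> S i j = D i 0 * E 0 j + D i 1 * E 1 j + D i 2 * E 2 j"
  shows "det3 (S 0) (S 1) (S 2) = det3 (D 0) (D 1) (D 2) * det3 (E 0) (E 1) (E 2)"
proof -
  have e: "S 0 j = D 0 0 * E 0 j + D 0 1 * E 1 j + D 0 2 * E 2 j"
    "S 1 j = D 1 0 * E 0 j + D 1 1 * E 1 j + D 1 2 * E 2 j"
    "S 2 j = D 2 0 * E 0 j + D 2 1 * E 1 j + D 2 2 * E 2 j" if "j < 3" for j
    using assms that by auto
  have "(0::nat) < 3" "(1::nat) < 3" "(2::nat) < 3" by simp_all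
  note e = e[OF this(1)] e[OF this(2)] e[OF this(3)]
  show ?thesis unfolding det3_def e by (simp add: algebra_simps)
qed

lemma det3_kernel:
  fixes D :: "nat \<Rightarrow> nat \<Rightarrow> real"
  assumes "det3 (D 0) (D 1) (D 2) \<noteq> 0"
    and "\<And>i. i < 3 \<Longrightarrow> D i 0 * x + D i 1 * y + D i 2 * z = 0"
  shows "x = 0" "y = 0" "z = 0"
proof -
  have e: "D 0 0 * x + D 0 1 * y + D 0 2 * z = 0" "D 1 0 * x + D 1 1 * y + D 1 2 * z = 0"
    "D 2 0 * x + D 2 1 * y + D 2 2 * z = 0"
    using assms(2) by simp_all
  have "det3 (D 0) (D 1) (D 2) * x = (D 0 0 * x + D 0 1 * y + D 0 2 * z) * (D 1 1 * D 2 2 - D 1 2 * D 2 1)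
      - (D 1 0 * x + D 1 1 * y + D 1 2 * z) * (D 0 1 * D 2 2 - D 0 2 * D 2 1)
      + (D 2 0 * x + D 2 1 * y + D 2 2 * z) * (D 0 1 * D 1 2 - D 0 2 * D 1 1)"
    "det3 (D 0) (D 1) (D 2) * y = (D 1 0 * x + D 1 1 * y + D 1 2 * z) * (D 0 0 * D 2 2 - D 0 2 * D 2 0)
      - (D 0 0 * x + D 0 1 * y + D 0 2 * z) * (D 1 0 * D 2 2 - D 1 2 * D 2 0)
      - (D 2 0 * x + D 2 1 * y + D 2 2 * z) * (D 0 0 * D 1 2 - D 0 2 * D 1 0)"
    "det3 (D 0) (D 1) (D 2) * z = (D 0 0 * x + D 0 1 * y + D 0 2 * z) * (D 1 0 * D 2 1 - D 1 1 * D 2 0)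
      - (D 1 0 * x + D 1 1 * y + D 1 2 * z) * (D 0 0 * D 2 1 - D 0 1 * D 2 0)
      + (D 2 0 * x + D 2 1 * y + D 2 2 * z) * (D 0 0 * D 1 1 - D 0 1 * D 1 0)"
    unfolding det3_def by (simp_all add: algebra_simps)
  then have "det3 (D 0) (D 1) (D 2) * x = 0" "det3 (D 0) (D 1) (D 2) * y = 0" "det3 (D 0) (D 1) (D 2) * z = 0"
    unfolding e by simp_all
  then show "x = 0" "y = 0" "z = 0" using assms(1) by simp_all
qed

lemma five_set:
  assumes "s < 5" "t < 5" "s \<noteq> t"
  obtains p q r :: nat where "{..<5} = {s, t, p, q, r}" "distinct [s, t, p, q, r]"
proof -
  have "card ({..<5} - {s, t}) = 3" using assms by (simp add: card_Diff_subset)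
  then obtain p q r where pqr: "{..<5} - {s, t} = {p, q, r}" "distinct [p, q, r]"
    by (auto simp: card_3_iff)
  then have "{..<5} = {s, t, p, q, r}" using assms by auto
  moreover have "distinct [s, t, p, q, r]" using pqr assms(3) by auto
  ultimately show ?thesis using that by blast
qed

lemma sum_five:
  assumes "{..<5::nat} = {s, t, p, q, r}" "distinct [s, t, p, q, r]"
  shows "(\<Sum>u<5. f u) = f s + f t + f p + f q + (f r :: real)"
  unfolding assms(1) using assms(2) by simp

text \<open>\<open>P\<close> holds the coordinates of every row in the first three rows, which are
  independent by \<open>top\<close>. By symmetry the row space equals the column space, so one
  defect map tests both factors of a factorization.\<close>

locale symmetric_rank3 =
  fixes n :: nat and S P :: "nat \<Rightarrow> nat \<Rightarrow> real"
  assumes n: "3 \<le> n"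
    and sym: "i < n \<Longrightarrow> j < n \<Longrightarrow> S i j = S j i"
    and rank3: "k < n \<Longrightarrow> j < n \<Longrightarrow> S k j = (\<Sum>i<3. P k i * S i j)"
    and top: "det3 (S 0) (S 1) (S 2) \<noteq> 0"
begin

text \<open>The column space of \<open>S\<close> consists of the vectors without defect.\<close>

definition defect :: "(nat \<Rightarrow> real) \<Rightarrow> nat \<Rightarrow> real" where
  "defect w k = w k - (\<Sum>i<3. P k i * w i)"

text \<open>The defect is linear and vanishes on the columns of \<open>S\<close>, which are
  combinations of the columns of \<open>B\<close>. So the rows of the defect matrix of
  \<open>B\<close> annihilate the columns of \<open>C\<close>.\<close>

lemma defect_columns:
  fixes B C :: "nat \<Rightarrow> nat \<Rightarrow> real"
  assumes "\<And>k j. k < n \<Longrightarrow> j < n \<Longrightarrow> S k j = (\<Sum>t<5. B k t * C t j)" "k < n" "j < n"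
  shows "(\<Sum>t<5. defect (\<lambda>i. B i t) k * C t j) = 0"
proof -
  have "(\<Sum>t<5. defect (\<lambda>i. B i t) k * C t j) =
      (\<Sum>t<5. B k t * C t j) - (\<Sum>t<5. \<Sum>i<3. P k i * (B i t * C t j))"
    by (simp only: defect_def left_diff_distrib sum_subtractf sum_distrib_right mult.assoc)
  also have "(\<Sum>t<5. \<Sum>i<3. P k i * (B i t * C t j)) = (\<Sum>i<3. P k i * (\<Sum>t<5. B i t * C t j))"
    by (subst sum.swap) (simp add: sum_distrib_left)
  also have "\<dots> = (\<Sum>i<3. P k i * S i j)"
    using assms n by (intro sum.cong refl) simp
  finally show ?thesis using rank3 assms by simp
qed

text \<open>A nonzero minor expresses two rows of \<open>C\<close> through the other three, which then span the row space of \<open>S\<close>.\<close>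

lemma minor_imp_transposed_defect_zero:
  fixes B C :: "nat \<Rightarrow> nat \<Rightarrow> real"
  assumes S: "\<And>k j. k < n \<Longrightarrow> j < n \<Longrightarrow> S k j = (\<Sum>t<5. B k t * C t j)"
    and kl: "k < n" "l < n" and st: "s < 5" "t < 5"
    and minor: "defect (\<lambda>i. B i s) k * defect (\<lambda>i. B i t) l - defect (\<lambda>i. B i t) k * defect (\<lambda>i. B i s) l \<noteq> 0"
    and m: "m < n" "u < 5"
  shows "defect (C u) m = 0"
proof -
  define M where "M k t = defect (\<lambda>i. B i t) k" for k t
  define \<Delta> where "\<Delta> = M k s * M l t - M k t * M l s"
  have \<Delta>: "\<Delta> \<noteq> 0" using minor by (simp add: \<Delta>_def M_def)
  have "s \<noteq> t" using \<Delta> by (auto simp: \<Delta>_def)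
  then obtain p q r where pqr: "{..<5} = {s, t, p, q, r}" "distinct [s, t, p, q, r]"
    using five_set st by metis
  \<comment> \<open>A Schur complement: \<open>D i v\<close> is \<open>\<Delta>\<close> times the
    coefficient of generator \<open>v\<close> after \<open>s\<close> and \<open>t\<close> have been
    eliminated by means of the rows \<open>k\<close> and \<open>l\<close> of
    \<open>M\<close>.\<close>
  define D where "D i v = \<Delta> * B i v - B i s * (M k v * M l t - M l v * M k t)
      - B i t * (M k s * M l v - M l s * M k v)" for i v
  define e where "e = (\<lambda>x. [p, q, r] ! x)"
  have elim: "\<Delta> * x s = - ((M k p * M l t - M l p * M k t) * x p + (M k q * M l t - M l q * M k t) * x q
        + (M k r * M l t - M l r * M k t) * x r)"
      "\<Delta> * x t = - ((M k s * M l p - M l s * M k p) * x p + (M k s * M l q - M l s * M k q) * x q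
        + (M k s * M l r - M l s * M k r) * x r)"
    if "(\<Sum>v<5. M k v * x v) = 0" "(\<Sum>v<5. M l v * x v) = 0" for x
  proof -
    have "\<Delta> * x s + ((M k p * M l t - M l p * M k t) * x p + (M k q * M l t - M l q * M k t) * x q
        + (M k r * M l t - M l r * M k t) * x r) = M l t * (\<Sum>v<5. M k v * x v) - M k t * (\<Sum>v<5. M l v * x v)"
      "\<Delta> * x t + ((M k s * M l p - M l s * M k p) * x p + (M k s * M l q - M l s * M k q) * x q
        + (M k s * M l r - M l s * M k r) * x r) = M k s * (\<Sum>v<5. M l v * x v) - M l s * (\<Sum>v<5. M k v * x v)"
      unfolding sum_five[OF pqr] \<Delta>_def by (simp_all add: algebra_simps)
    then show "\<Delta> * x s = - ((M k p * M l t - M l p * M k t) * x p + (M k q * M l t - M l q * M k t) * x q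
        + (M k r * M l t - M l r * M k t) * x r)"
      "\<Delta> * x t = - ((M k s * M l p - M l s * M k p) * x p + (M k s * M l q - M l s * M k q) * x q
        + (M k s * M l r - M l s * M k r) * x r)"
      using that by simp_all
  qed
  have DS: "\<Delta> * (\<Sum>v<5. B i v * x v) = D i p * x p + D i q * x q + D i r * x r"
    if "(\<Sum>v<5. M k v * x v) = 0" "(\<Sum>v<5. M l v * x v) = 0" for x i
  proof -
    have "\<Delta> * (\<Sum>v<5. B i v * x v) = B i s * (\<Delta> * x s) + B i t * (\<Delta> * x t)
        + \<Delta> * (B i p * x p + B i q * x q + B i r * x r)"
      unfolding sum_five[OF pqr] by (simp add: algebra_simps)
    then show ?thesis unfolding elim[OF that] D_def by (simp add: algebra_simps)
  qed
  have MC: "(\<Sum>v<5. M i v * C v j) = 0" if "i < n" "j < n" for i j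
    unfolding M_def using defect_columns[OF S that] by simp
  have MN: "(\<Sum>v<5. M i v * defect (C v) m) = 0" if "i < n" for i
  proof -
    have "(\<Sum>v<5. M i v * defect (C v) m) = (\<Sum>v<5. M i v * C v m) - (\<Sum>v<5. \<Sum>a<3. P m a * (M i v * C v a))"
      by (simp add: defect_def right_diff_distrib sum_subtractf sum_distrib_left mult_ac)
    also have "(\<Sum>v<5. \<Sum>a<3. P m a * (M i v * C v a)) = (\<Sum>a<3. P m a * (\<Sum>v<5. M i v * C v a))"
      by (subst sum.swap) (simp add: sum_distrib_left)
    finally show ?thesis using MC that m n by simp
  qed
  have BN: "(\<Sum>v<5. B i v * defect (C v) m) = 0" if "i < n" for i
  proof -
    have "(\<Sum>v<5. defect (\<lambda>a. C v a) m * B i v) = 0"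
      using defect_columns[of "\<lambda>a v. C v a" "\<lambda>v a. B a v" m i] that m sym S by (simp add: mult.commute)
    then show ?thesis by (simp add: mult.commute)
  qed
  \<comment> \<open>Up to the factor \<open>\<Delta>\<close>, the leading block of \<open>S\<close>
    factors through the generators \<open>p\<close>, \<open>q\<close>, \<open>r\<close>. Hence
    \<open>top\<close> makes this 3-by-3 block of \<open>D\<close> invertible, and the defects of
    \<open>C\<close>, which it annihilates, vanish.\<close>
  have "det3 (\<lambda>j. \<Delta> * S 0 j) (\<lambda>j. \<Delta> * S 1 j) (\<lambda>j. \<Delta> * S 2 j) \<noteq> 0"
    unfolding det3_scale using \<Delta> top by simp
  moreover have "det3 (\<lambda>j. \<Delta> * S 0 j) (\<lambda>j. \<Delta> * S 1 j) (\<lambda>j. \<Delta> * S 2 j) =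
      det3 (\<lambda>v. D 0 (e v)) (\<lambda>v. D 1 (e v)) (\<lambda>v. D 2 (e v)) * det3 (C (e 0)) (C (e 1)) (C (e 2))"
    by (rule det3_mult[of "\<lambda>i j. \<Delta> * S i j" "\<lambda>i v. D i (e v)" "\<lambda>v. C (e v)"])
      (use n in \<open>simp add: S e_def DS[OF MC MC] kl\<close>)
  ultimately have "det3 (\<lambda>v. D 0 (e v)) (\<lambda>v. D 1 (e v)) (\<lambda>v. D 2 (e v)) \<noteq> 0"
    by auto
  moreover have "D i (e 0) * defect (C p) m + D i (e 1) * defect (C q) m + D i (e 2) * defect (C r) m = 0"
    if "i < 3" for i
    using DS[OF MN MN, OF kl, of i] BN[of i] that n by (simp add: e_def)
  ultimately have zero: "defect (C p) m = 0" "defect (C q) m = 0" "defect (C r) m = 0"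
    using det3_kernel[of "\<lambda>i v. D i (e v)" "defect (C p) m" "defect (C q) m" "defect (C r) m"] by blast+
  then have "defect (C s) m = 0" "defect (C t) m = 0"
    using elim[OF MN MN, OF kl] \<Delta> by simp_all
  moreover have "u \<in> {s, t, p, q, r}" using m(2) pqr(1) by blast
  ultimately show ?thesis using zero by auto
qed

end

context symmetric_rank3
begin

text \<open>A dimension count: with inner dimension 5 and rank 3, the dimensions by which the two
  factors exceed the column space add up to at most 2. A nonzero 2-by-2 minor of the defect matrix
  of \<open>B\<close> uses up both; otherwise that matrix is an outer product.\<close>

lemma defect_rank_one:
  fixes B C :: "nat \<Rightarrow> nat \<Rightarrow> real"
  assumes S: "\<And>k j. k < n \<Longrightarrow> j < n \<Longrightarrow> S k j = (\<Sum>t<5. B k t * C t j)"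
  shows "(\<exists>\<phi> \<alpha>. (\<forall>k<n. \<forall>t<5. defect (\<lambda>i. B i t) k = \<alpha> k * \<phi> t) \<and>
            (\<forall>j<n. (\<Sum>t<5. \<phi> t * C t j) = 0) \<and>
            (\<forall>t<5. (\<forall>k<n. B k t = 0) \<longrightarrow> \<phi> t = 0)) \<or>
         (\<forall>k<n. \<forall>t<5. defect (C t) k = 0)"
proof (cases "\<exists>k<n. \<exists>l<n. \<exists>s<5. \<exists>t<5.
    defect (\<lambda>i. B i s) k * defect (\<lambda>i. B i t) l - defect (\<lambda>i. B i t) k * defect (\<lambda>i. B i s) l \<noteq> 0")
  case True
  then show ?thesis using minor_imp_transposed_defect_zero[OF S] by blast
next
  case False
  then have minor: "defect (\<lambda>i. B i s) k * defect (\<lambda>i. B i t) l = defect (\<lambda>i. B i t) k * defect (\<lambda>i. B i s) l"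
    if "k < n" "l < n" "s < 5" "t < 5" for k l s t
    using that by auto
  show ?thesis
  proof (cases "\<exists>k<n. \<exists>t<5. defect (\<lambda>i. B i t) k \<noteq> 0")
    case True
    then obtain k0 t0 where 0: "k0 < n" "t0 < 5" "defect (\<lambda>i. B i t0) k0 \<noteq> 0" by blast
    define \<phi> where "\<phi> t = defect (\<lambda>i. B i t) k0" for t
    define \<alpha> where "\<alpha> k = defect (\<lambda>i. B i t0) k / \<phi> t0" for k
    have "defect (\<lambda>i. B i t) k = \<alpha> k * \<phi> t" if "k < n" "t < 5" for k t
      using minor[OF that(1) 0(1) that(2) 0(2)] 0(3) by (simp add: \<phi>_def \<alpha>_def field_simps)
    moreover have "(\<Sum>t<5. \<phi> t * C t j) = 0" if "j < n" for j
      unfolding \<phi>_def using defect_columns[OF S 0(1) that] by simp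
    moreover have "\<phi> t = 0" if "\<forall>k<n. B k t = 0" for t
      using that n 0(1) by (simp add: \<phi>_def defect_def)
    ultimately show ?thesis by blast
  next
    case False
    then show ?thesis
      by (intro disjI1 exI[of _ "\<lambda>_. 0"] exI[of _ "\<lambda>_. 0"]) auto
  qed
qed

text \<open>Since \<open>S\<close> is symmetric, transposing swaps the factors; in the second
  alternative the transposed factorization is taken with \<open>\<phi>\<close> equal to zero. The
  zero columns from \<open>r\<close> on admit factorizations with fewer than five
  generators.\<close>

lemma defect_rank_one_wlog:
  fixes B C :: "nat \<Rightarrow> nat \<Rightarrow> real"
  assumes S: "\<And>k j. k < n \<Longrightarrow> j < n \<Longrightarrow> S k j = (\<Sum>t<5. B k t * C t j)"
    and B: "\<And>k t. k < n \<Longrightarrow> t < 5 \<Longrightarrow> 0 \<le> B k t" "\<And>k t. k < n \<Longrightarrow> r \<le> t \<Longrightarrow> B k t = 0"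
    and C: "\<And>t k. t < 5 \<Longrightarrow> k < n \<Longrightarrow> 0 \<le> C t k" "\<And>t k. r \<le> t \<Longrightarrow> k < n \<Longrightarrow> C t k = 0"
  obtains B' C' \<phi> \<alpha> where
    "\<And>k j. k < n \<Longrightarrow> j < n \<Longrightarrow> S k j = (\<Sum>t<5. B' k t * C' t j)"
    "\<And>k t. k < n \<Longrightarrow> t < 5 \<Longrightarrow> (0::real) \<le> B' k t" "\<And>k t. k < n \<Longrightarrow> r \<le> t \<Longrightarrow> B' k t = 0"
    "\<And>t k. t < 5 \<Longrightarrow> k < n \<Longrightarrow> (0::real) \<le> C' t k"
    "\<And>k t. k < n \<Longrightarrow> t < 5 \<Longrightarrow> defect (\<lambda>i. B' i t) k = \<alpha> k * \<phi> t"
    "\<And>j. j < n \<Longrightarrow> (\<Sum>t<5. \<phi> t * C' t j) = 0"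
    "\<And>t. t < 5 \<Longrightarrow> (\<forall>k<n. B' k t = 0) \<Longrightarrow> \<phi> t = 0"
proof -
  note goal = that
  consider \<phi> \<alpha> where "\<forall>k<n. \<forall>t<5. defect (\<lambda>i. B i t) k = \<alpha> k * \<phi> t"
      "\<forall>j<n. (\<Sum>t<5. \<phi> t * C t j) = 0" "\<forall>t<5. (\<forall>k<n. B k t = 0) \<longrightarrow> \<phi> t = 0"
    | "\<forall>k<n. \<forall>t<5. defect (C t) k = 0"
    using defect_rank_one[OF S] by blast
  then show ?thesis
  proof cases
    case 1
    then show ?thesis using S B C by (intro goal[of B C \<alpha> \<phi>]) auto
  next
    case 2
    have "S k j = (\<Sum>t<5. C t k * B j t)" if "k < n" "j < n" for k j
      using sym[OF that] S[OF that(2,1)] by (simp add: mult.commute)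
    then show ?thesis using 2 B C
      by (intro goal[of "\<lambda>k t. C t k" "\<lambda>t k. B k t" "\<lambda>_. 0" "\<lambda>_. 0"]) auto
  qed
qed

end

text \<open>The columns are the vertices and the rows the edges of a polygon. \<open>extreme\<close>
  says that the zeros of column \<open>j\<close> fix a vector of the column space up to a scalar;
  the entry 1 in row \<open>k0\<close> makes this scalar \<open>w k0\<close>.\<close>

locale slack_matrix = symmetric_rank3 +
  assumes nonneg: "i < n \<Longrightarrow> j < n \<Longrightarrow> 0 \<le> S i j"
    and extreme: "j < n \<Longrightarrow> \<exists>k0<n. S k0 j = 1 \<and> (\<forall>w. (\<forall>k<n. w k = (\<Sum>i<3. P k i * w i)) \<longrightarrow>
      (\<forall>k<n. S k j = 0 \<longrightarrow> w k = 0) \<longrightarrow> (\<forall>k<n. w k = w k0 * S k j))"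
    and distinct_zeros: "i < n \<Longrightarrow> j < n \<Longrightarrow> i \<noteq> j \<Longrightarrow> \<exists>k<n. S k i = 0 \<and> S k j \<noteq> 0"
begin

lemma extreme_column:
  assumes "j < n" "\<And>k. k < n \<Longrightarrow> defect w k = 0" "\<And>k. k < n \<Longrightarrow> 0 \<le> w k"
    and "\<And>k. k < n \<Longrightarrow> S k j = 0 \<Longrightarrow> w k = 0" "\<exists>k<n. w k \<noteq> 0"
  shows "\<exists>\<kappa>>0. \<forall>k<n. w k = \<kappa> * S k j"
proof -
  have "\<forall>k<n. w k = (\<Sum>i<3. P k i * w i)" "\<forall>k<n. S k j = 0 \<longrightarrow> w k = 0"
    using assms(2,4) by (simp_all add: defect_def)
  then obtain k0 where k0: "k0 < n" "\<forall>k<n. w k = w k0 * S k j"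
    using extreme[OF assms(1)] by blast
  have "w k0 \<noteq> 0" using k0(2) assms(5) by (metis mult_zero_left)
  then have "0 < w k0" using assms(3)[OF k0(1)] by simp
  then show ?thesis using k0(2) by blast
qed

text \<open>Nonnegativity makes every generator used by column \<open>j\<close> vanish wherever the
  column does. If such a generator has \<open>\<phi>\<close> equal to zero, it lies in the column
  space and is a multiple of the column by extremality. Otherwise generators of both signs are used,
  because \<open>\<phi>\<close> annihilates column \<open>j\<close> of \<open>C\<close>, and
  division by \<open>\<phi>\<close> cancels the defects in their difference.\<close>

lemma column_generator_pair:
  fixes B C :: "nat \<Rightarrow> nat \<Rightarrow> real"
  assumes S: "\<And>k j. k < n \<Longrightarrow> j < n \<Longrightarrow> S k j = (\<Sum>t<5. B k t * C t j)"
    and B: "\<And>k t. k < n \<Longrightarrow> t < 5 \<Longrightarrow> 0 \<le> B k t"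
    and C: "\<And>t k. t < 5 \<Longrightarrow> k < n \<Longrightarrow> 0 \<le> C t k"
    and \<phi>: "\<And>k t. k < n \<Longrightarrow> t < 5 \<Longrightarrow> defect (\<lambda>i. B i t) k = \<alpha> k * \<phi> t"
      "\<And>j. j < n \<Longrightarrow> (\<Sum>t<5. \<phi> t * C t j) = 0"
      "\<And>t. t < 5 \<Longrightarrow> (\<forall>k<n. B k t = 0) \<Longrightarrow> \<phi> t = 0"
    and j: "j < n"
  shows "\<exists>s t. s < 5 \<and> t < 5 \<and>
     (s = t \<and> \<phi> s = 0 \<and> (\<exists>k<n. B k s \<noteq> 0) \<and> (\<exists>\<kappa>>0. \<forall>k<n. B k s = \<kappa> * S k j) \<or>
      0 < \<phi> s \<and> \<phi> t < 0 \<and> (\<exists>\<kappa>>0. \<forall>k<n. B k s / \<phi> s - B k t / \<phi> t = \<kappa> * S k j))"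
proof -
  have supp: "B k t = 0" if "k < n" "t < 5" "S k j = 0" "0 < C t j" for k t
  proof -
    have "(\<Sum>u<5. B k u * C u j) = 0" using S[OF \<open>k < n\<close> j] that by simp
    then have "B k t * C t j = 0"
      using that B C j by (subst (asm) sum_nonneg_eq_0_iff) auto
    then show ?thesis using that by simp
  qed
  obtain k where k: "k < n" "S k j \<noteq> 0"
  proof -
    have "(if j = 0 then 1 else 0) < n" "(if j = 0 then 1 else 0) \<noteq> j" using n by auto
    then show ?thesis using distinct_zeros[OF _ j] that by blast
  qed
  then have "(\<Sum>t<5. B k t * C t j) \<noteq> 0" using S j by simp
  then obtain t0 where t0: "t0 < 5" "B k t0 * C t0 j \<noteq> 0"
    by (meson lessThan_iff sum.not_neutral_contains_not_neutral)
  then have C0: "0 < C t0 j" using C[of t0 j] j by (auto simp: less_le)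
  show ?thesis
  proof (cases "\<phi> t0 = 0")
    case True
    have "\<exists>\<kappa>>0. \<forall>k<n. B k t0 = \<kappa> * S k j"
      using True t0 \<phi>(1) B supp[OF _ t0(1) _ C0] k by (intro extreme_column[OF j]) auto
    then show ?thesis using True t0 k by (intro exI[of _ t0]) auto
  next
    case False
    have ex: "\<exists>t<5. \<psi> t < 0 \<and> 0 < C t j"
      if "(\<Sum>t<5. \<psi> t * C t j) = 0" "0 < \<psi> t0" for \<psi> :: "nat \<Rightarrow> real"
    proof (rule ccontr)
      assume "\<not> ?thesis"
      then have "0 \<le> \<psi> t * C t j" if "t < 5" for t
        using C[OF that j] that by (cases "C t j = 0") (auto simp: less_le not_less)
      then have "\<psi> t0 * C t0 j = 0" using that(1) t0(1) by (subst (asm) sum_nonneg_eq_0_iff) auto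
      then show False using that(2) C0 by simp
    qed
    obtain s t where st: "s < 5" "t < 5" "0 < \<phi> s" "\<phi> t < 0" "0 < C s j" "0 < C t j"
    proof (cases "0 < \<phi> t0")
      case True
      then show ?thesis using ex[OF \<phi>(2)[OF j]] that t0 C0 by blast
    next
      case neg: False
      then show ?thesis using ex[of "\<lambda>t. - \<phi> t"] \<phi>(2)[OF j] that t0 C0 False
        by (auto simp: sum_negf)
    qed
    have "\<exists>\<kappa>>0. \<forall>k<n. B k s / \<phi> s - B k t / \<phi> t = \<kappa> * S k j"
    proof (rule extreme_column[OF j])
      fix k assume k: "k < n"
      have "defect (\<lambda>k. B k s / \<phi> s - B k t / \<phi> t) k = defect (\<lambda>i. B i s) k / \<phi> s - defect (\<lambda>i. B i t) k / \<phi> t"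
        by (simp add: defect_def right_diff_distrib sum_subtractf diff_divide_distrib sum_divide_distrib)
      then show "defect (\<lambda>k. B k s / \<phi> s - B k t / \<phi> t) k = 0"
        using \<phi>(1)[OF k] st by simp
      show pos: "0 \<le> B k s / \<phi> s - B k t / \<phi> t"
        using B[OF k] st by (smt (verit) divide_nonneg_pos divide_nonneg_neg)
      show "B k s / \<phi> s - B k t / \<phi> t = 0" if "S k j = 0"
        using supp[OF k _ that] st by simp
    next
      obtain k where k: "k < n" "B k s \<noteq> 0" using \<phi>(3)[of s] st by auto
      then have "0 < B k s / \<phi> s" "B k t / \<phi> t \<le> 0"
        using B[OF k(1)] st by (auto simp: less_le intro: divide_nonneg_neg)
      then show "\<exists>k<n. B k s / \<phi> s - B k t / \<phi> t \<noteq> 0" using k(1) by (intro exI[of _ k]) auto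
    qed
    then show ?thesis using st by blast
  qed
qed

lemma not_proportional:
  assumes "i < n" "j < n" "0 < x" "0 < y" "\<And>k. k < n \<Longrightarrow> x * S k i = y * S k j"
  shows "i = j"
proof (rule ccontr)
  assume "i \<noteq> j"
  then obtain k where "k < n" "S k i = 0" "S k j \<noteq> 0" using distinct_zeros assms by blast
  then show False using assms(4) assms(5)[of k] by simp
qed

end

section \<open>Counting pairs of generators\<close>

lemma product_bound_small:
  fixes p q z r :: nat
  assumes "p + q + z \<le> r" "r \<le> 4"
  shows "p * q + z \<le> r"
proof -
  consider "p = 0" | "p = 1" | "p = 2" | "p = 3" | "p = 4" using assms by linarith
  then show ?thesis using assms by cases simp_all
qed

text \<open>\<open>p\<close>, \<open>q\<close>, \<open>z\<close> will count the generators with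
  positive, negative and zero \<open>\<phi>\<close>, so that \<open>p * q + z\<close> bounds the
  number of vertices. With at most five generators only a 2-by-3 grid reaches six.\<close>

lemma product_bound_five:
  fixes p q z :: nat
  assumes "p + q + z \<le> 5" "6 \<le> p * q + z"
  shows "z = 0 \<and> (p = 2 \<and> q = 3 \<or> p = 3 \<and> q = 2)"
proof -
  consider "p = 0" | "p = 1" | "p = 2" | "p = 3" | "p = 4" | "p = 5" using assms(1) by linarith
  then show ?thesis using assms by cases auto
qed

context slack_matrix
begin

text \<open>Projectively, and for distinct \<open>i\<close> and \<open>j\<close>, \<open>d\<close>
  is a point of the line through these two vertices other than the vertices themselves.\<close>

definition on_line :: "(nat \<Rightarrow> real) \<Rightarrow> nat \<Rightarrow> nat \<Rightarrow> bool" where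
  "on_line d i j \<longleftrightarrow> (\<exists>x y. x \<noteq> 0 \<and> y \<noteq> 0 \<and> (\<forall>k<n. d k = x * S k i + y * S k j))"

lemma on_line_sym: "on_line d i j \<Longrightarrow> on_line d j i"
  unfolding on_line_def by (metis add.commute)

text \<open>\<open>column_generator_pair\<close> assigns to each vertex a pair of generators, a
  diagonal pair being a single one. The pair determines the ray and hence the vertex, which gives
  injectivity. Only nonzero generators occur, so all indices are below \<open>r\<close>. The
  functions \<open>f\<close> and \<open>g\<close> absorb the division by
  \<open>\<phi>\<close>.\<close>

lemma pair_structure:
  fixes B C :: "nat \<Rightarrow> nat \<Rightarrow> real"
  assumes S: "\<And>k j. k < n \<Longrightarrow> j < n \<Longrightarrow> S k j = (\<Sum>t<5. B k t * C t j)"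
    and B: "\<And>k t. k < n \<Longrightarrow> t < 5 \<Longrightarrow> 0 \<le> B k t" "\<And>k t. k < n \<Longrightarrow> r \<le> t \<Longrightarrow> B k t = 0"
    and C: "\<And>t k. t < 5 \<Longrightarrow> k < n \<Longrightarrow> 0 \<le> C t k" "\<And>t k. r \<le> t \<Longrightarrow> k < n \<Longrightarrow> C t k = 0"
    and r: "r \<le> 5"
  obtains f :: "nat \<Rightarrow> nat \<Rightarrow> real" and g :: "nat \<Rightarrow> nat \<Rightarrow> real" and U V Z :: "nat set" and \<pi> :: "nat \<Rightarrow> nat \<times> nat"
  where "finite U" "finite V" "finite Z" "card U + card V + card Z \<le> r" "inj_on \<pi> {..<n}"
    "\<pi> ` {..<n} \<subseteq> U \<times> V \<union> (\<lambda>z. (z, z)) ` Z"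
    "\<And>j s t. j < n \<Longrightarrow> s \<in> U \<Longrightarrow> t \<in> V \<Longrightarrow> \<pi> j = (s, t) \<Longrightarrow>
       \<exists>\<kappa>>0. \<forall>k<n. f s k + g t k = \<kappa> * S k j"
proof -
  obtain B' C' \<phi> \<alpha> where S': "\<And>k j. k < n \<Longrightarrow> j < n \<Longrightarrow> S k j = (\<Sum>t<5. B' k t * C' t j)"
    and B': "\<And>k t. k < n \<Longrightarrow> t < 5 \<Longrightarrow> (0::real) \<le> B' k t" "\<And>k t. k < n \<Longrightarrow> r \<le> t \<Longrightarrow> B' k t = 0"
    and C': "\<And>t k. t < 5 \<Longrightarrow> k < n \<Longrightarrow> (0::real) \<le> C' t k"
    and \<phi>: "\<And>k t. k < n \<Longrightarrow> t < 5 \<Longrightarrow> defect (\<lambda>i. B' i t) k = \<alpha> k * \<phi> t"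
      "\<And>j. j < n \<Longrightarrow> (\<Sum>t<5. \<phi> t * C' t j) = 0"
      "\<And>t. t < 5 \<Longrightarrow> (\<forall>k<n. B' k t = 0) \<Longrightarrow> \<phi> t = 0"
    by (rule defect_rank_one_wlog[OF S B C]) auto
  define U where "U = {t. t < r \<and> 0 < \<phi> t}"
  define V where "V = {t. t < r \<and> \<phi> t < 0}"
  define Z where "Z = {t. t < r \<and> \<phi> t = 0}"
  have lt: "t < r" if "t < 5" "\<phi> t \<noteq> 0 \<or> (\<exists>k<n. B' k t \<noteq> 0)" for t
    using that \<phi>(3)[of t] B'(2)[of _ t] by (meson not_less)
  define R where "R j s t \<longleftrightarrow> s < 5 \<and> t < 5 \<and>
     (s = t \<and> \<phi> s = 0 \<and> (\<exists>k<n. B' k s \<noteq> 0) \<and> (\<exists>\<kappa>>0. \<forall>k<n. B' k s = \<kappa> * S k j) \<or>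
      0 < \<phi> s \<and> \<phi> t < 0 \<and> (\<exists>\<kappa>>0. \<forall>k<n. B' k s / \<phi> s - B' k t / \<phi> t = \<kappa> * S k j))" for j s t
  have "\<exists>s t. R j s t" if "j < n" for j
    unfolding R_def by (rule column_generator_pair[OF S' B'(1) C' \<phi> that])
  then have "\<exists>st. R j (fst st) (snd st)" if "j < n" for j
    using that by simp
  then obtain \<pi> where \<pi>: "\<And>j. j < n \<Longrightarrow> R j (fst (\<pi> j)) (snd (\<pi> j))"
    by metis
  have fin: "finite U" "finite V" "finite Z" by (simp_all add: U_def V_def Z_def)
  have "card U + card V + card Z = card (U \<union> V \<union> Z)"
    using fin by (subst card_Un_disjoint; (subst card_Un_disjoint)?) (auto simp: U_def V_def Z_def)
  also have "\<dots> \<le> card {..<r}" by (rule card_mono) (auto simp: U_def V_def Z_def)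
  finally have card: "card U + card V + card Z \<le> r" by simp
  have inj: "inj_on \<pi> {..<n}"
  proof (rule inj_onI)
    fix i j assume ij: "i \<in> {..<n}" "j \<in> {..<n}" and eq: "\<pi> i = \<pi> j"
    obtain s t where st: "\<pi> j = (s, t)" by fastforce
    have "R i s t" "R j s t" using \<pi>[of i] \<pi>[of j] ij eq st by auto
    then obtain x y where "0 < x" "0 < y" "\<And>k. k < n \<Longrightarrow> x * S k i = y * S k j"
      unfolding R_def by (auto; metis)
    then show "i = j" using not_proportional[of i j x y] ij by auto
  qed
  have sub: "\<pi> ` {..<n} \<subseteq> U \<times> V \<union> (\<lambda>z. (z, z)) ` Z"
  proof
    fix st assume "st \<in> \<pi> ` {..<n}"
    then obtain j where j: "j < n" "st = \<pi> j" by auto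
    obtain s t where st: "\<pi> j = (s, t)" by fastforce
    have "R j s t" using \<pi>[OF j(1)] st by simp
    then consider "s < 5" "s = t" "\<phi> s = 0" "\<exists>k<n. B' k s \<noteq> 0" | "s < 5" "t < 5" "0 < \<phi> s" "\<phi> t < 0"
      unfolding R_def by blast
    then show "st \<in> U \<times> V \<union> (\<lambda>z. (z, z)) ` Z"
      unfolding j(2) st
    proof cases
      case 1
      then have "s \<in> Z" using lt[of s] by (simp add: Z_def)
      then show "(s, t) \<in> U \<times> V \<union> (\<lambda>z. (z, z)) ` Z" using 1 by simp
    next
      case 2
      then have "s \<in> U" "t \<in> V" using lt[of s] lt[of t] by (simp_all add: U_def V_def)
      then show "(s, t) \<in> U \<times> V \<union> (\<lambda>z. (z, z)) ` Z" by simp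
    qed
  qed
  have "\<exists>\<kappa>>0. \<forall>k<n. B' k s / \<phi> s + (- (B' k t / \<phi> t)) = \<kappa> * S k j"
    if "j < n" "s \<in> U" "t \<in> V" "\<pi> j = (s, t)" for j s t
  proof -
    have "R j s t" "\<phi> s \<noteq> 0" using \<pi>[OF that(1)] that(2,4) by (simp_all add: U_def)
    then show ?thesis unfolding R_def by simp
  qed
  then show ?thesis
    by (rule that[OF fin card inj sub, of "\<lambda>s k. B' k s / \<phi> s" "\<lambda>t k. - (B' k t / \<phi> t)"])
qed

text \<open>Counting leaves only six vertices that fill a grid of two times three generators. The
  difference \<open>d\<close> of the two generators on the short side is, for each generator on the
  long side, a combination of the two corresponding vertices; this puts \<open>d\<close> on three
  lines.\<close>

lemma no_small_factor:
  fixes B C :: "nat \<Rightarrow> nat \<Rightarrow> real"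
  assumes S: "\<And>k j. k < n \<Longrightarrow> j < n \<Longrightarrow> S k j = (\<Sum>t<5. B k t * C t j)"
    and B: "\<And>k t. k < n \<Longrightarrow> t < 5 \<Longrightarrow> 0 \<le> B k t" "\<And>k t. k < n \<Longrightarrow> r \<le> t \<Longrightarrow> B k t = 0"
    and C: "\<And>t k. t < 5 \<Longrightarrow> k < n \<Longrightarrow> 0 \<le> C t k" "\<And>t k. r \<le> t \<Longrightarrow> k < n \<Longrightarrow> C t k = 0"
    and r: "r \<le> 5" "r < n"
  shows "n = 6 \<and> (\<exists>d i1 j1 i2 j2 i3 j3. {i1, j1, i2, j2, i3, j3} \<subseteq> {..<6} \<and>
    distinct [i1, j1, i2, j2, i3, j3] \<and> on_line d i1 j1 \<and> on_line d i2 j2 \<and> on_line d i3 j3)"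
proof (rule pair_structure[OF S B C r(1)])
  fix f g :: "nat \<Rightarrow> nat \<Rightarrow> real" and U V Z and \<pi> :: "nat \<Rightarrow> nat \<times> nat"
  assume fin: "finite U" "finite V" "finite Z" and card: "card U + card V + card Z \<le> r"
    and inj: "inj_on \<pi> {..<n}" and sub: "\<pi> ` {..<n} \<subseteq> U \<times> V \<union> (\<lambda>z. (z, z)) ` Z"
    and eq: "\<And>j s t. j < n \<Longrightarrow> s \<in> U \<Longrightarrow> t \<in> V \<Longrightarrow> \<pi> j = (s, t) \<Longrightarrow>
       \<exists>\<kappa>>0. \<forall>k<n. f s k + g t k = \<kappa> * S k j"
  have "n = card (\<pi> ` {..<n})" using inj by (simp add: card_image)
  also have "\<dots> \<le> card (U \<times> V \<union> (\<lambda>z. (z, z)) ` Z)" using fin sub by (intro card_mono) auto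
  also have "\<dots> \<le> card (U \<times> V) + card ((\<lambda>z. (z, z)) ` Z)" by (rule card_Un_le)
  also have "\<dots> \<le> card U * card V + card Z"
    using card_image_le[OF fin(3), of "\<lambda>z. (z, z)"] by (simp add: card_cartesian_product)
  finally have le: "n \<le> card U * card V + card Z" .
  have "r = 5"
    using product_bound_small[OF card] le r by (cases "r \<le> 4") auto
  then have z: "card Z = 0" and uv: "card U = 2 \<and> card V = 3 \<or> card U = 3 \<and> card V = 2"
    using product_bound_five[of "card U" "card V" "card Z"] card le r(2) by auto
  have n6: "n = 6" using le r(2) \<open>r = 5\<close> z uv by auto
  have "Z = {}" using z fin by simp
  have "\<pi> ` {..<n} = U \<times> V"
    using sub fin uv card_image[OF inj] n6 \<open>Z = {}\<close>
    by (intro card_subset_eq) (auto simp: card_cartesian_product)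
  then have "\<exists>j<n. \<pi> j = (s, t)" if "s \<in> U" "t \<in> V" for s t
    using that by (metis (no_types, lifting) SigmaI imageE lessThan_iff)
  then obtain J where J: "\<And>s t. s \<in> U \<Longrightarrow> t \<in> V \<Longrightarrow> J s t < n \<and> \<pi> (J s t) = (s, t)"
    by metis
  have Jiff: "J s t = J s' t' \<longleftrightarrow> s = s' \<and> t = t'" if "s \<in> U" "t \<in> V" "s' \<in> U" "t' \<in> V" for s t s' t'
    using J[OF that(1,2)] J[OF that(3,4)] by (metis prod.inject)
  have Jlt: "J s t < 6" if "s \<in> U" "t \<in> V" for s t
    using J[OF that] n6 by simp
  have line1: "on_line (\<lambda>k. f s k - f s' k) (J s t) (J s' t)" if st: "s \<in> U" "s' \<in> U" "t \<in> V" for s s' t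
  proof -
    obtain x y where xy: "x > 0" "y > 0" "\<forall>k<n. f s k + g t k = x * S k (J s t)"
      "\<forall>k<n. f s' k + g t k = y * S k (J s' t)"
      using eq[of "J s t" s t] eq[of "J s' t" s' t] J[OF st(1,3)] J[OF st(2,3)] st by auto
    have "f s k - f s' k = x * S k (J s t) + (- y) * S k (J s' t)" if "k < n" for k
      using xy(3)[rule_format, OF that] xy(4)[rule_format, OF that] by (simp add: algebra_simps)
    then show ?thesis unfolding on_line_def using xy(1,2) by (intro exI[of _ x] exI[of _ "- y"]) auto
  qed
  have line2: "on_line (\<lambda>k. g t k - g t' k) (J s t) (J s t')" if st: "t \<in> V" "t' \<in> V" "s \<in> U" for s t' t
  proof -
    obtain x y where xy: "x > 0" "y > 0" "\<forall>k<n. f s k + g t k = x * S k (J s t)"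
      "\<forall>k<n. f s k + g t' k = y * S k (J s t')"
      using eq[of "J s t" s t] eq[of "J s t'" s t'] J[OF st(3,1)] J[OF st(3,2)] st by auto
    have "g t k - g t' k = x * S k (J s t) + (- y) * S k (J s t')" if "k < n" for k
      using xy(3)[rule_format, OF that] xy(4)[rule_format, OF that] by (simp add: algebra_simps)
    then show ?thesis unfolding on_line_def using xy(1,2) by (intro exI[of _ x] exI[of _ "- y"]) auto
  qed
  from uv have "\<exists>d i1 j1 i2 j2 i3 j3. {i1, j1, i2, j2, i3, j3} \<subseteq> {..<6} \<and>
    distinct [i1, j1, i2, j2, i3, j3] \<and> on_line d i1 j1 \<and> on_line d i2 j2 \<and> on_line d i3 j3"
  proof
    assume "card U = 2 \<and> card V = 3"
    then obtain s s' t1 t2 t3 where U: "U = {s, s'}" "s \<noteq> s'"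
      and V: "V = {t1, t2, t3}" "t1 \<noteq> t2" "t1 \<noteq> t3" "t2 \<noteq> t3"
      by (auto simp: card_2_iff card_3_iff)
    let ?d = "\<lambda>k. f s k - f s' k"
    have "on_line ?d (J s t1) (J s' t1)" "on_line ?d (J s t2) (J s' t2)" "on_line ?d (J s t3) (J s' t3)"
      by (rule line1; simp add: U V)+
    moreover have "distinct [J s t1, J s' t1, J s t2, J s' t2, J s t3, J s' t3]"
      using U(2) V(2-4) by (simp add: Jiff U(1) V(1))
    moreover have "{J s t1, J s' t1, J s t2, J s' t2, J s t3, J s' t3} \<subseteq> {..<6}"
      by (simp add: Jlt U(1) V(1))
    ultimately show ?thesis by blast
  next
    assume "card U = 3 \<and> card V = 2"
    then obtain t t' s1 s2 s3 where V: "V = {t, t'}" "t \<noteq> t'"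
      and U: "U = {s1, s2, s3}" "s1 \<noteq> s2" "s1 \<noteq> s3" "s2 \<noteq> s3"
      by (auto simp: card_2_iff card_3_iff)
    let ?d = "\<lambda>k. g t k - g t' k"
    have "on_line ?d (J s1 t) (J s1 t')" "on_line ?d (J s2 t) (J s2 t')" "on_line ?d (J s3 t) (J s3 t')"
      by (rule line2; simp add: U V)+
    moreover have "distinct [J s1 t, J s1 t', J s2 t, J s2 t', J s3 t, J s3 t']"
      using V(2) U(2-4) by (simp add: Jiff U(1) V(1))
    moreover have "{J s1 t, J s1 t', J s2 t, J s2 t', J s3 t, J s3 t'} \<subseteq> {..<6}"
      by (simp add: Jlt U(1) V(1))
    ultimately show ?thesis by blast
  qed
  with n6 show ?thesis by simp
qed

end

text \<open>The polygons are self-polar: edge \<open>i\<close> is the polar of vertex \<open>i\<close>, so their slack matrices are symmetric.\<close>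

definition "triangle_slack = (\<lambda>i j. [[1, 0, 0], [0, 1, 0], [0, 0, 1]] ! i ! j :: real)"
definition "square_slack = (\<lambda>i j. [[0, 0, 1, 1], [0, 1, 1, 0], [1, 1, 0, 0], [1, 0, 0, 1]] ! i ! j :: real)"
definition "pentagon_slack = (\<lambda>i j. [[0, 0, 1, 1, 1], [0, 1, 2, 1, 0], [1, 2, 1, 0, 0], [1, 1, 0, 0, 1],
  [1, 0, 0, 1, 3]] ! i ! j :: real)"
text \<open>Row \<open>i\<close> vanishes exactly where \<open>i + j\<close> is 0 or 1 modulo 6,
  that is, at two consecutive vertices. A regular hexagon would not do, since its three long
  diagonals meet in one point.\<close>

definition "hexagon_slack = (\<lambda>i j. [[0, 0, 1, 1, 2, 1], [0, 1, 4, 2, 3, 0], [1, 4, 6, 1, 0, 0], [1, 2, 1, 0, 0, 3],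
  [2, 3, 0, 0, 1, 8], [1, 0, 0, 3, 8, 10]] ! i ! j :: real)"

section \<open>Verification of the four slack matrices\<close>

lemma all_less:
  fixes Q :: "nat \<Rightarrow> bool"
  shows "(\<forall>k<3. Q k) \<longleftrightarrow> Q 0 \<and> Q 1 \<and> Q 2"
    "(\<forall>k<4. Q k) \<longleftrightarrow> Q 0 \<and> Q 1 \<and> Q 2 \<and> Q 3"
    "(\<forall>k<5. Q k) \<longleftrightarrow> Q 0 \<and> Q 1 \<and> Q 2 \<and> Q 3 \<and> Q 4"
    "(\<forall>k<6. Q k) \<longleftrightarrow> Q 0 \<and> Q 1 \<and> Q 2 \<and> Q 3 \<and> Q 4 \<and> Q 5"
  by (simp_all add: numeral_eq_Suc All_less_Suc conj_ac)

lemma ex_less: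
  fixes Q :: "nat \<Rightarrow> bool"
  shows "(\<exists>k<3. Q k) \<longleftrightarrow> Q 0 \<or> Q 1 \<or> Q 2"
    "(\<exists>k<4. Q k) \<longleftrightarrow> Q 0 \<or> Q 1 \<or> Q 2 \<or> Q 3"
    "(\<exists>k<5. Q k) \<longleftrightarrow> Q 0 \<or> Q 1 \<or> Q 2 \<or> Q 3 \<or> Q 4"
    "(\<exists>k<6. Q k) \<longleftrightarrow> Q 0 \<or> Q 1 \<or> Q 2 \<or> Q 3 \<or> Q 4 \<or> Q 5"
  by (simp_all add: numeral_eq_Suc Ex_less_Suc disj_ac)

lemma sum_three: "(\<Sum>i<3::nat. f i) = f 0 + f 1 + (f 2 :: real)"
  by (simp add: eval_nat_numeral)

text \<open>For concrete entries all conditions become finite conjunctions; \<open>K j\<close> names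
  a row in which column \<open>j\<close> has entry 1. Extremality turns into linear identities, as
  the first three entries of \<open>w\<close> determine the others.\<close>

lemma slack_matrixI:
  fixes S P :: "nat \<Rightarrow> nat \<Rightarrow> real" and K :: "nat \<Rightarrow> nat"
  assumes "3 \<le> n" "\<forall>i<n. \<forall>j<n. S i j = S j i" "\<forall>k<n. \<forall>j<n. S k j = (\<Sum>i<3. P k i * S i j)"
    "det3 (S 0) (S 1) (S 2) \<noteq> 0" "\<forall>i<n. \<forall>j<n. 0 \<le> S i j" "\<forall>j<n. K j < n \<and> S (K j) j = 1"
    "\<And>w. (\<forall>k<n. w k = (\<Sum>i<3. P k i * w i)) \<Longrightarrow>
       \<forall>j<n. (\<forall>k<n. S k j = 0 \<longrightarrow> w k = 0) \<longrightarrow> (\<forall>k<n. w k = w (K j) * S k j)"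
    "\<forall>i<n. \<forall>j<n. i \<noteq> j \<longrightarrow> (\<exists>k<n. S k i = 0 \<and> S k j \<noteq> 0)"
  shows "slack_matrix n S P"
proof
  show "\<exists>k0<n. S k0 j = 1 \<and> (\<forall>w. (\<forall>k<n. w k = (\<Sum>i<3. P k i * w i)) \<longrightarrow>
      (\<forall>k<n. S k j = 0 \<longrightarrow> w k = 0) \<longrightarrow> (\<forall>k<n. w k = w k0 * S k j))" if "j < n" for j
  proof (intro exI[of _ "K j"] conjI allI impI)
    show "K j < n" "S (K j) j = 1" using assms(6) that by simp_all
    show "w k = w (K j) * S k j" if "\<forall>k<n. w k = (\<Sum>i<3. P k i * w i)" "\<forall>k<n. S k j = 0 \<longrightarrow> w k = 0" "k < n" for w k
      using assms(7)[OF that(1)] that(2,3) \<open>j < n\<close> by blast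
  qed
  show "3 \<le> n" by (fact assms(1))
  show "det3 (S 0) (S 1) (S 2) \<noteq> 0" by (fact assms(4))
  show "S i j = S j i" if "i < n" "j < n" for i j by (rule assms(2)[rule_format, OF that])
  show "S k j = (\<Sum>i<3. P k i * S i j)" if "k < n" "j < n" for k j by (rule assms(3)[rule_format, OF that])
  show "0 \<le> S i j" if "i < n" "j < n" for i j by (rule assms(5)[rule_format, OF that])
  show "\<exists>k<n. S k i = 0 \<and> S k j \<noteq> 0" if "i < n" "j < n" "i \<noteq> j" for i j
    by (rule assms(8)[rule_format, OF that])
qed

lemma triangle: "slack_matrix 3 triangle_slack triangle_slack"
  by (rule slack_matrixI[where K = "\<lambda>j. j"])
    (simp_all add: all_less ex_less sum_three det3_def triangle_slack_def)

lemma square: "slack_matrix 4 square_slack (\<lambda>i j. [[1, 0, 0], [0, 1, 0], [0, 0, 1], [1, -1, 1]] ! i ! j)"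
  by (rule slack_matrixI[where K = "\<lambda>j. [2, 1, 0, 0] ! j"])
    (simp_all add: all_less ex_less sum_three det3_def square_slack_def)

lemma pentagon: "slack_matrix 5 pentagon_slack
    (\<lambda>i j. [[1, 0, 0], [0, 1, 0], [0, 0, 1], [1, -1, 1], [3, -2, 1]] ! i ! j)"
  by (rule slack_matrixI[where K = "\<lambda>j. [2, 1, 0, 0, 0] ! j"])
    (simp_all add: all_less ex_less sum_three det3_def pentagon_slack_def)

text \<open>Column 4 begins with 2, 3, 0, so its entry 1 is taken from row 4.\<close>

lemma hexagon: "slack_matrix 6 hexagon_slack
    (\<lambda>i j. [[1, 0, 0], [0, 1, 0], [0, 0, 1], [3, -2, 1], [8, -5, 2], [10, -4, 1]] ! i ! j)"
  by (rule slack_matrixI[where K = "\<lambda>j. [2, 1, 0, 0, 4, 0] ! j"])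
    (simp_all add: all_less ex_less sum_three det3_def hexagon_slack_def)

section \<open>Perfect matchings of six vertices and concurrent lines\<close>

lemma split_four:
  assumes sub: "{b, c, d, e} \<subseteq> {p, q, r, s}" and d: "distinct [b, c, d, e]" "distinct [p, q, r, s]"
    and T: "\<And>x y. T x y \<Longrightarrow> T y x" "T b c" "T d e"
  shows "T p q \<and> T r s \<or> T p r \<and> T q s \<or> T p s \<and> T q r"
proof -
  have pair: "T x y" if "v \<in> {x, y}" "w \<in> {x, y}" "v \<noteq> w" "T v w" for v w x y
    using that T(1)[OF that(4)] by auto
  have split: "T p q \<and> T r s \<or> T p r \<and> T q s \<or> T p s \<and> T q r"
    if h: "T p u" "T v w" "distinct [p, u, v, w]" "{u, v, w} \<subseteq> {p, q, r, s}" for u v w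
  proof -
    consider "u = q" | "u = r" | "u = s" using h(3,4) by auto
    then show ?thesis
    proof cases
      case 1
      then have "T r s" by (intro pair[OF _ _ _ h(2)]) (use h(3,4) in auto)
      then show ?thesis using 1 h(1) by simp
    next
      case 2
      then have "T q s" by (intro pair[OF _ _ _ h(2)]) (use h(3,4) in auto)
      then show ?thesis using 2 h(1) by simp
    next
      case 3
      then have "T q r" by (intro pair[OF _ _ _ h(2)]) (use h(3,4) in auto)
      then show ?thesis using 3 h(1) by simp
    qed
  qed
  have "card {b, c, d, e} = 4" "card {p, q, r, s} = 4" using d by simp_all
  then have eq: "{b, c, d, e} = {p, q, r, s}"
    using sub by (intro card_subset_eq) simp_all
  then consider "p = b" | "p = c" | "p = d" | "p = e" by blast
  then show ?thesis
  proof cases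
    case 1 then show ?thesis by (intro split[of c d e]) (use T(2,3) d(1) sub in auto)
  next
    case 2 then show ?thesis by (intro split[of b d e]) (use T(1)[OF T(2)] T(3) d(1) sub in auto)
  next
    case 3 then show ?thesis by (intro split[of e b c]) (use T(2,3) d(1) sub in auto)
  next
    case 4 then show ?thesis by (intro split[of d b c]) (use T(1)[OF T(3)] T(2) d(1) sub in auto)
  qed
qed

text \<open>The excluded cases are the 15 perfect matchings of six points: five partners of 0, and
  for each of them the three matchings of the other four points from
  \<open>split_four\<close>.\<close>

lemma split_six:
  fixes T :: "nat \<Rightarrow> nat \<Rightarrow> bool"
  assumes sub: "{i1, j1, i2, j2, i3, j3} \<subseteq> {..<6}" and d: "distinct [i1, j1, i2, j2, i3, j3]"
    and T: "\<And>x y. T x y \<Longrightarrow> T y x" "T i1 j1" "T i2 j2" "T i3 j3"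
    and no:
    "\<not> (T 0 1 \<and> T 2 3 \<and> T 4 5)" "\<not> (T 0 1 \<and> T 2 4 \<and> T 3 5)" "\<not> (T 0 1 \<and> T 2 5 \<and> T 3 4)"
    "\<not> (T 0 2 \<and> T 1 3 \<and> T 4 5)" "\<not> (T 0 2 \<and> T 1 4 \<and> T 3 5)" "\<not> (T 0 2 \<and> T 1 5 \<and> T 3 4)"
    "\<not> (T 0 3 \<and> T 1 2 \<and> T 4 5)" "\<not> (T 0 3 \<and> T 1 4 \<and> T 2 5)" "\<not> (T 0 3 \<and> T 1 5 \<and> T 2 4)"
    "\<not> (T 0 4 \<and> T 1 2 \<and> T 3 5)" "\<not> (T 0 4 \<and> T 1 3 \<and> T 2 5)" "\<not> (T 0 4 \<and> T 1 5 \<and> T 2 3)"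
    "\<not> (T 0 5 \<and> T 1 2 \<and> T 3 4)" "\<not> (T 0 5 \<and> T 1 3 \<and> T 2 4)" "\<not> (T 0 5 \<and> T 1 4 \<and> T 2 3)"
  shows False
proof -
  have "{i1, j1, i2, j2, i3, j3} = {..<6}"
    using sub d by (intro card_subset_eq) auto
  then have "0 \<in> {i1, j1, i2, j2, i3, j3}" by simp
  then have "\<exists>a b c d e. T 0 a \<and> T b c \<and> T d e \<and> distinct [0, a, b, c, d, e] \<and> {a, b, c, d, e} \<subseteq> {..<6}"
  proof -
    have ex: "\<exists>a b c d e. T 0 a \<and> T b c \<and> T d e \<and> distinct [0, a, b, c, d, e] \<and> {a, b, c, d, e} \<subseteq> {..<6}"
      if "x = 0" "T x a" "T b c" "T d e" "distinct [x, a, b, c, d, e]" "{a, b, c, d, e} \<subseteq> {..<6}" for x a b c d e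
      using that by blast
    from \<open>0 \<in> {i1, j1, i2, j2, i3, j3}\<close>
    consider "i1 = 0" | "j1 = 0" | "i2 = 0" | "j2 = 0" | "i3 = 0" | "j3 = 0" by auto
    then show ?thesis
    proof cases
      case 1 then show ?thesis by (rule ex[of i1 j1 i2 j2 i3 j3]) (use T d sub in auto)
    next
      case 2 then show ?thesis by (rule ex[of j1 i1 i2 j2 i3 j3]) (use T(1)[OF T(2)] T d sub in auto)
    next
      case 3 then show ?thesis by (rule ex[of i2 j2 i1 j1 i3 j3]) (use T d sub in auto)
    next
      case 4 then show ?thesis by (rule ex[of j2 i2 i1 j1 i3 j3]) (use T(1)[OF T(3)] T d sub in auto)
    next
      case 5 then show ?thesis by (rule ex[of i3 j3 i1 j1 i2 j2]) (use T d sub in auto)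
    next
      case 6 then show ?thesis by (rule ex[of j3 i3 i1 j1 i2 j2]) (use T(1)[OF T(4)] T d sub in auto)
    qed
  qed
  then obtain a b c d e where T': "T 0 a" "T b c" "T d e" and
    d': "distinct [0, a, b, c, d, e]" and sub': "{a, b, c, d, e} \<subseteq> {..<6}" by blast
  have dbc: "distinct [b, c, d, e]" using d' by simp
  have "\<forall>x\<in>{a, b, c, d, e}. x < 6" using sub' by auto
  then have a: "a < 6" and lt: "\<forall>x\<in>{b, c, d, e}. x < 6" by simp_all
  have "\<forall>x\<in>{b, c, d, e}. x \<noteq> 0 \<and> x \<noteq> a" using d' by auto
  then have bcde: "x < 6 \<and> x \<noteq> 0 \<and> x \<noteq> a" if "x \<in> {b, c, d, e}" for x
    using lt that by blast
  have "a \<noteq> 0" using d' by simp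
  then consider "a = 1" | "a = 2" | "a = 3" | "a = 4" | "a = 5" using a by linarith
  then show False
  proof cases
    case 1
    have "{b, c, d, e} \<subseteq> {2, 3, 4, 5}"
      by (rule subsetI, drule bcde, unfold 1 insert_iff empty_iff, presburger)
    from split_four[OF this dbc _ T(1) T'(2,3)] show False using 1 T'(1) no by auto
  next
    case 2
    have "{b, c, d, e} \<subseteq> {1, 3, 4, 5}"
      by (rule subsetI, drule bcde, unfold 2 insert_iff empty_iff, presburger)
    from split_four[OF this dbc _ T(1) T'(2,3)] show False using 2 T'(1) no by auto
  next
    case 3
    have "{b, c, d, e} \<subseteq> {1, 2, 4, 5}"
      by (rule subsetI, drule bcde, unfold 3 insert_iff empty_iff, presburger)
    from split_four[OF this dbc _ T(1) T'(2,3)] show False using 3 T'(1) no by auto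
  next
    case 4
    have "{b, c, d, e} \<subseteq> {1, 2, 3, 5}"
      by (rule subsetI, drule bcde, unfold 4 insert_iff empty_iff, presburger)
    from split_four[OF this dbc _ T(1) T'(2,3)] show False using 4 T'(1) no by auto
  next
    case 5
    have "{b, c, d, e} \<subseteq> {1, 2, 3, 4}"
      by (rule subsetI, drule bcde, unfold 5 insert_iff empty_iff, presburger)
    from split_four[OF this dbc _ T(1) T'(2,3)] show False using 5 T'(1) no by auto
  qed
qed

interpretation hexagon: slack_matrix 6 hexagon_slack
    "\<lambda>i j. [[1, 0, 0], [0, 1, 0], [0, 0, 1], [3, -2, 1], [8, -5, 2], [10, -4, 1]] ! i ! j"
  by (rule hexagon)

text \<open>Equating the three expressions for \<open>d\<close> in the rows 0, 1, 2 eliminates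
  \<open>d\<close> and leaves six homogeneous linear equations in six unknowns.\<close>

lemma hexagon_on_lineE:
  assumes "hexagon.on_line d a b \<and> hexagon.on_line d c e \<and> hexagon.on_line d f g"
  obtains x1 y1 x2 y2 x3 y3 where "x1 \<noteq> 0"
    "x1 * hexagon_slack 0 a + y1 * hexagon_slack 0 b = x2 * hexagon_slack 0 c + y2 * hexagon_slack 0 e"
    "x1 * hexagon_slack 1 a + y1 * hexagon_slack 1 b = x2 * hexagon_slack 1 c + y2 * hexagon_slack 1 e"
    "x1 * hexagon_slack 2 a + y1 * hexagon_slack 2 b = x2 * hexagon_slack 2 c + y2 * hexagon_slack 2 e"
    "x1 * hexagon_slack 0 a + y1 * hexagon_slack 0 b = x3 * hexagon_slack 0 f + y3 * hexagon_slack 0 g"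
    "x1 * hexagon_slack 1 a + y1 * hexagon_slack 1 b = x3 * hexagon_slack 1 f + y3 * hexagon_slack 1 g"
    "x1 * hexagon_slack 2 a + y1 * hexagon_slack 2 b = x3 * hexagon_slack 2 f + y3 * hexagon_slack 2 g"
proof -
  obtain x1 y1 x2 y2 x3 y3 where "x1 \<noteq> 0"
    and d: "\<forall>k<6. d k = x1 * hexagon_slack k a + y1 * hexagon_slack k b"
      "\<forall>k<6. d k = x2 * hexagon_slack k c + y2 * hexagon_slack k e"
      "\<forall>k<6. d k = x3 * hexagon_slack k f + y3 * hexagon_slack k g"
    using assms unfolding hexagon.on_line_def by blast
  have e: "x1 * hexagon_slack k a + y1 * hexagon_slack k b = x2 * hexagon_slack k c + y2 * hexagon_slack k e"
    "x1 * hexagon_slack k a + y1 * hexagon_slack k b = x3 * hexagon_slack k f + y3 * hexagon_slack k g"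
    if "k < 6" for k
    using d[rule_format, OF that] by simp_all
  show ?thesis
    by (rule that[OF \<open>x1 \<noteq> 0\<close> e(1) e(1) e(1) e(2) e(2) e(2)]) simp_all
qed

lemma hexagon_entries:
  shows
    "hexagon_slack 0 0 = 0" "hexagon_slack 0 1 = 0" "hexagon_slack 0 2 = 1" "hexagon_slack 0 3 = 1" "hexagon_slack 0 4 = 2" "hexagon_slack 0 5 = 1"
    "hexagon_slack 1 0 = 0" "hexagon_slack 1 1 = 1" "hexagon_slack 1 2 = 4" "hexagon_slack 1 3 = 2" "hexagon_slack 1 4 = 3" "hexagon_slack 1 5 = 0"
    "hexagon_slack 2 0 = 1" "hexagon_slack 2 1 = 4" "hexagon_slack 2 2 = 6" "hexagon_slack 2 3 = 1" "hexagon_slack 2 4 = 0" "hexagon_slack 2 5 = 0"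
  by (simp_all add: hexagon_slack_def)

text \<open>For each of the 15 matchings, the six equations of \<open>hexagon_on_lineE\<close> force
  \<open>x1 = 0\<close>.\<close>

lemma hexagon_no_concurrent_lines:
  fixes d :: "nat \<Rightarrow> real"
  defines "T \<equiv> hexagon.on_line d"
  shows
    "\<not> (T 0 1 \<and> T 2 3 \<and> T 4 5)" "\<not> (T 0 1 \<and> T 2 4 \<and> T 3 5)" "\<not> (T 0 1 \<and> T 2 5 \<and> T 3 4)"
    "\<not> (T 0 2 \<and> T 1 3 \<and> T 4 5)" "\<not> (T 0 2 \<and> T 1 4 \<and> T 3 5)" "\<not> (T 0 2 \<and> T 1 5 \<and> T 3 4)"
    "\<not> (T 0 3 \<and> T 1 2 \<and> T 4 5)" "\<not> (T 0 3 \<and> T 1 4 \<and> T 2 5)" "\<not> (T 0 3 \<and> T 1 5 \<and> T 2 4)"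
    "\<not> (T 0 4 \<and> T 1 2 \<and> T 3 5)" "\<not> (T 0 4 \<and> T 1 3 \<and> T 2 5)" "\<not> (T 0 4 \<and> T 1 5 \<and> T 2 3)"
    "\<not> (T 0 5 \<and> T 1 2 \<and> T 3 4)" "\<not> (T 0 5 \<and> T 1 3 \<and> T 2 4)" "\<not> (T 0 5 \<and> T 1 4 \<and> T 2 3)"
  unfolding T_def
  by (rule notI, erule hexagon_on_lineE, erule notE, unfold hexagon_entries, linarith)+

section \<open>Rank and nonnegative rank\<close>

text \<open>Rank is subadditive, and each of the \<open>r\<close> summands is an outer
  product.\<close>

lemma rank_le_factor:
  fixes A :: "real mat"
  assumes "A \<in> carrier_mat m n" "\<And>i j. i < m \<Longrightarrow> j < n \<Longrightarrow> A $$ (i, j) = (\<Sum>t<r. F i t * V t j)"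
  shows "vec_space.rank m A \<le> r"
  using assms
proof (induction r arbitrary: A)
  case 0
  then have "A = 0\<^sub>m m n" by (intro eq_matI) auto
  then show ?case by (simp add: vec_space.rank_0I)
next
  case (Suc r)
  define A1 where "A1 = mat m n (\<lambda>(i, j). \<Sum>t<r. F i t * V t j)"
  define A2 where "A2 = mat m n (\<lambda>(i, j). F i r * V r j)"
  have A1: "A1 \<in> carrier_mat m n" and A2: "A2 \<in> carrier_mat m n" by (simp_all add: A1_def A2_def)
  have "A = A1 + A2"
    using Suc.prems A1 A2 by (intro eq_matI) (auto simp: A1_def A2_def)
  moreover have "vec_space.rank m A1 \<le> r"
    by (rule Suc.IH[OF A1]) (simp add: A1_def)
  moreover have "vec_space.rank m A2 \<le> 1"
    by (rule vec_space.rank_le_1_product_entries[OF A2, where f = "\<lambda>i. F i r" and g = "V r"])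
       (simp add: A2_def)
  ultimately show ?case
    using vec_space.rank_subadditive[OF A1 A2] by simp
qed

text \<open>A maximal independent set of columns of \<open>A\<close> supplies \<open>F\<close>, and
  \<open>V\<close> collects the coordinates of all columns in it.\<close>

lemma rank_factor:
  fixes A :: "real mat"
  assumes A: "A \<in> carrier_mat m n"
  shows "\<exists>F V. \<forall>i<m. \<forall>j<n. A $$ (i, j) = (\<Sum>t<vec_space.rank m A. F i t * V t j)"
proof -
  interpret vec_space "TYPE(real)" m .
  have cols: "set (cols A) \<subseteq> carrier_vec m" using cols_dim A by blast
  have "lin_indpt {}"
    by (metis (no_types) empty_subsetI fin_dim finite_basis_exists subset_li_is_li vec_vs vectorspace.basis_def)
  then obtain S where S: "finite S" "maximal S (\<lambda>T. T \<subseteq> set (cols A) \<and> lin_indpt T)"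
    using maximal_exists_superset[of "set (cols A)" "\<lambda>T. T \<subseteq> set (cols A) \<and> lin_indpt T" "{}"] by auto
  have sub: "S \<subseteq> set (cols A)" and ind: "lin_indpt S"
    using S(2) by (auto simp: maximal_def)
  have carr: "S \<subseteq> carrier_vec m" using sub cols by auto
  have rank: "rank A = card S" by (rule rank_card_indpt[OF A S(2)])
  have span: "v \<in> span S" if v: "v \<in> set (cols A)" for v
  proof (rule ccontr)
    assume nv: "v \<notin> span S"
    have "v \<in> carrier V" using v cols by auto
    then have "lin_indpt (S \<union> {v})"
      using lindep_span lin_dep_iff_in_span[of S v] carr ind nv span_mem[of S v] by auto
    moreover have "S \<union> {v} \<subseteq> set (cols A)" using sub v by auto
    ultimately have "S \<union> {v} = S" using S(2) unfolding maximal_def by blast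
    then show False using nv span_mem[OF carr] by blast
  qed
  obtain g where g: "bij_betw g {..<card S} S"
    using ex_bij_betw_nat_finite[OF S(1)] atLeast0LessThan by metis
  have "\<exists>c. \<forall>i<m. A $$ (i, j) = (\<Sum>t<card S. g t $ i * c (g t))" if j: "j < n" for j
  proof -
    have "col A j \<in> set (cols A)" using j A by (auto simp: cols_def)
    then have "col A j \<in> span S" by (rule span)
    then obtain c where c: "col A j = lincomb c S"
      using finite_in_span[OF S(1), of "col A j"] carr by (metis module_vec_simps(3))
    have "A $$ (i, j) = (\<Sum>t<card S. g t $ i * c (g t))" if i: "i < m" for i
    proof -
      have "A $$ (i, j) = lincomb c S $ i" using A i j c[symmetric] by simp
      also have "\<dots> = (\<Sum>v\<in>S. c v * v $ i)" using lincomb_index[OF i carr] .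
      also have "\<dots> = (\<Sum>t<card S. c (g t) * g t $ i)"
        by (rule sum.reindex_bij_betw[OF g, symmetric])
      finally show ?thesis by (simp add: mult.commute)
    qed
    then show ?thesis by blast
  qed
  then obtain c where "\<And>j. j < n \<Longrightarrow> \<forall>i<m. A $$ (i, j) = (\<Sum>t<card S. g t $ i * c j (g t))"
    by metis
  then show ?thesis unfolding rank
    by (intro exI[of _ "\<lambda>i t. g t $ i"] exI[of _ "\<lambda>t j. c j (g t)"]) simp
qed

lemma (in symmetric_rank3) rank_mat:
  "vec_space.rank n (mat n n (\<lambda>(i, j). S i j)) = 3"
proof (rule antisym)
  let ?A = "mat n n (\<lambda>(i, j). S i j)"
  show "vec_space.rank n ?A \<le> 3"
    by (rule rank_le_factor[where n = n and F = P and V = S]) (simp_all add: rank3)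
  show "3 \<le> vec_space.rank n ?A"
  proof (rule ccontr)
    let ?r = "vec_space.rank n ?A"
    assume "\<not> 3 \<le> ?r"
    then have r: "?r \<le> 2" by simp
    obtain F V where FV: "\<forall>i<n. \<forall>j<n. ?A $$ (i, j) = (\<Sum>t<?r. F i t * V t j)"
      using rank_factor[of ?A n n] by auto
    \<comment> \<open>Padding with zeros to width three: a rank of at most 2 leaves the last column
      zero, so the leading minor would vanish.\<close>
    define D where "D i t = (if t < ?r then F i t else 0)" for i t
    have "S i j = D i 0 * V 0 j + D i 1 * V 1 j + D i 2 * V 2 j" if "i < 3" "j < 3" for i j
    proof -
      have "S i j = (\<Sum>t<?r. F i t * V t j)" using FV that n by auto
      also have "\<dots> = (\<Sum>t<?r. D i t * V t j)" by (simp add: D_def)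
      also have "\<dots> = (\<Sum>t<3. D i t * V t j)"
        using r by (intro sum.mono_neutral_left) (auto simp: D_def)
      finally show ?thesis by (simp add: eval_nat_numeral)
    qed
    from det3_mult[OF this] have "det3 (S 0) (S 1) (S 2) = det3 (D 0) (D 1) (D 2) * det3 (V 0) (V 1) (V 2)" .
    moreover have "D i 2 = 0" for i using r by (simp add: D_def)
    ultimately show False using top by (simp add: det3_def)
  qed
qed

section \<open>From generators to the nonnegative rank of a matrix\<close>

lemma nonneg_rank_le:
  assumes "A \<in> carrier_mat m n" "nonneg_factor m n k (\<lambda>i j. A $$ (i, j))"
  shows "nonneg_rank A \<le> k"
proof -
  obtain B where B: "\<forall>i<m. \<forall>t<k. 0 \<le> B i t"
    and "\<forall>j<n. conic_comb m k B (\<lambda>i. A $$ (i, j))"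
    using assms(2) unfolding nonneg_factor_def by blast
  then have "\<forall>j<n. \<exists>c. (\<forall>t<k. 0 \<le> c t) \<and> (\<forall>i<m. A $$ (i, j) = (\<Sum>t<k. B i t * c t))"
    unfolding conic_comb_def by blast
  then obtain C where C: "\<And>j. j < n \<Longrightarrow> (\<forall>t<k. 0 \<le> C j t) \<and> (\<forall>i<m. A $$ (i, j) = (\<Sum>t<k. B i t * C j t))"
    by metis
  let ?B = "mat m k (\<lambda>(i, t). B i t)" and ?C = "mat k n (\<lambda>(t, j). C j t)"
  have "nonneg_mat ?B" "nonneg_mat ?C" using B C by (simp_all add: nonneg_mat_def)
  moreover have "A = ?B * ?C"
  proof (rule eq_matI)
    fix i j assume "i < dim_row (?B * ?C)" "j < dim_col (?B * ?C)"
    then have ij: "i < m" "j < n" by simp_all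
    then have "(?B * ?C) $$ (i, j) = (\<Sum>t<k. B i t * C j t)"
      by (simp add: scalar_prod_def atLeast0LessThan)
    then show "A $$ (i, j) = (?B * ?C) $$ (i, j)" using C[OF ij(2)] ij(1) by simp
  qed (use assms(1) in auto)
  ultimately show ?thesis unfolding nonneg_rank_def
    using assms(1) by (intro Least_le bexI[of _ ?B] bexI[of _ ?C]) auto
qed

lemma nonneg_rank_le_columns:
  assumes "A \<in> carrier_mat m n" "nonneg_mat A"
  shows "nonneg_rank A \<le> n"
proof (rule nonneg_rank_le[OF assms(1)])
  have "conic_comb m n (\<lambda>i j. A $$ (i, j)) (\<lambda>i. A $$ (i, j))" if "j < n" for j
    unfolding conic_comb_def using that
    by (intro exI[of _ "\<lambda>t. if t = j then 1 else 0"]) (simp add: if_distrib cong: if_cong)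
  then show "nonneg_factor m n n (\<lambda>i j. A $$ (i, j))"
    unfolding nonneg_factor_def using assms by (intro exI[of _ "\<lambda>i j. A $$ (i, j)"]) (auto simp: nonneg_mat_def)
qed

text \<open>It is enough to save one generator on the first seven columns.\<close>

lemma nonneg_rank_less:
  assumes A: "A \<in> carrier_mat m n" "nonneg_mat A" and n: "7 \<le> n" and rank: "vec_space.rank m A = 3"
  shows "nonneg_rank A < n"
proof -
  have nn: "0 \<le> A $$ (i, j)" if "i < m" "j < n" for i j
    using A that by (auto simp: nonneg_mat_def)
  obtain F V :: "nat \<Rightarrow> nat \<Rightarrow> real"
    where FV: "\<forall>i<m. \<forall>j<n. A $$ (i, j) = (\<Sum>t<3. F i t * V t j)"
    using rank_factor[OF A(1), unfolded rank] by blast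
  have "nonneg_factor m 7 6 (\<lambda>i j. A $$ (i, j))"
    by (rule seven_columns_factor[where F = F and V = "\<lambda>j t. V t j"]) (use FV nn n in auto)
  then have "nonneg_factor m n (n - 1) (\<lambda>i j. A $$ (i, j))"
    using nn n by (intro nonneg_factor_append_columns) auto
  from nonneg_rank_le[OF A(1) this] n show ?thesis by simp
qed

lemma (in slack_matrix) nonneg_rank_eq:
  assumes "n \<le> 6"
    and lines: "\<And>d i1 j1 i2 j2 i3 j3. n = 6 \<Longrightarrow> {i1, j1, i2, j2, i3, j3} \<subseteq> {..<6} \<Longrightarrow>
      distinct [i1, j1, i2, j2, i3, j3] \<Longrightarrow> on_line d i1 j1 \<Longrightarrow> on_line d i2 j2 \<Longrightarrow> on_line d i3 j3 \<Longrightarrow> False"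
  shows "\<exists>A \<in> carrier_mat n n. nonneg_mat A \<and> vec_space.rank n A = 3 \<and> nonneg_rank A = n"
proof -
  define A where "A = mat n n (\<lambda>(i, j). S i j)"
  have A: "A \<in> carrier_mat n n" "nonneg_mat A"
    using nonneg by (simp_all add: A_def nonneg_mat_def)
  let ?r = "nonneg_rank A"
  have "\<not> ?r < n"
  proof
    assume r: "?r < n"
    obtain B C where B: "B \<in> carrier_mat n ?r" "nonneg_mat B" and C: "C \<in> carrier_mat ?r n" "nonneg_mat C"
      and "A = B * C"
      using nonneg_rank_witness[OF A] by blast
    \<comment> \<open>\<open>no_small_factor\<close> expects five generators. From
      \<open>?r < n\<close> and \<open>n \<le> 6\<close> there are at most five, and the missing
      ones are set to zero.\<close>
    define B' where "B' i t = (if t < ?r then B $$ (i, t) else 0)" for i t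
    define C' where "C' t j = (if t < ?r then C $$ (t, j) else 0)" for t j
    have "S k j = (\<Sum>t<5. B' k t * C' t j)" if "k < n" "j < n" for k j
    proof -
      have "S k j = (B * C) $$ (k, j)" using that \<open>A = B * C\<close>[symmetric] by (simp add: A_def)
      also have "\<dots> = (\<Sum>t<?r. B' k t * C' t j)"
        using B(1) C(1) that by (simp add: scalar_prod_def atLeast0LessThan B'_def C'_def)
      also have "\<dots> = (\<Sum>t<5. B' k t * C' t j)"
        using r assms(1) by (intro sum.mono_neutral_left) (auto simp: B'_def)
      finally show ?thesis .
    qed
    moreover have "0 \<le> B' k t" if "k < n" for k t
      using B that by (auto simp: B'_def nonneg_mat_def)
    moreover have "0 \<le> C' t k" if "k < n" for k t
      using C that by (auto simp: C'_def nonneg_mat_def)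
    ultimately have "n = 6 \<and> (\<exists>d i1 j1 i2 j2 i3 j3. {i1, j1, i2, j2, i3, j3} \<subseteq> {..<6} \<and>
        distinct [i1, j1, i2, j2, i3, j3] \<and> on_line d i1 j1 \<and> on_line d i2 j2 \<and> on_line d i3 j3)"
      using r assms(1) by (intro no_small_factor[of B' C' ?r]) (simp_all add: B'_def C'_def)
    then obtain d i1 j1 i2 j2 i3 j3 where "n = 6" "{i1, j1, i2, j2, i3, j3} \<subseteq> {..<6}"
        "distinct [i1, j1, i2, j2, i3, j3]" "on_line d i1 j1" "on_line d i2 j2" "on_line d i3 j3"
      by (elim conjE exE)
    then show False by (rule lines)
  qed
  then have "?r = n" using nonneg_rank_le_columns[OF A] by simp
  then show ?thesis using A rank_mat unfolding A_def[symmetric] by blast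
qed

theorem theorem3p3:
  shows "(\<forall>m n. \<forall>A \<in> carrier_mat m n.
            n \<ge> 7 \<longrightarrow> nonneg_mat A \<longrightarrow> vec_space.rank m A = 3 \<longrightarrow> nonneg_rank A < n) \<and>
         (\<forall>k \<in> {3, 4, 5, 6}. \<exists>A \<in> carrier_mat k k.
            nonneg_mat A \<and> vec_space.rank k A = 3 \<and> nonneg_rank A = k)"
proof (intro conjI allI ballI impI)
  show "nonneg_rank A < n"
    if "A \<in> carrier_mat m n" "7 \<le> n" "nonneg_mat A" "vec_space.rank m A = 3" for m n A
    using nonneg_rank_less that by blast
next
  fix k :: nat assume "k \<in> {3, 4, 5, 6}"
  then consider "k = 3" | "k = 4" | "k = 5" | "k = 6" by blast
  then show "\<exists>A \<in> carrier_mat k k. nonneg_mat A \<and> vec_space.rank k A = 3 \<and> nonneg_rank A = k"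
  proof cases
    case 1
    show ?thesis unfolding 1 by (rule slack_matrix.nonneg_rank_eq[OF triangle]) simp_all
  next
    case 2
    show ?thesis unfolding 2 by (rule slack_matrix.nonneg_rank_eq[OF square]) simp_all
  next
    case 3
    show ?thesis unfolding 3 by (rule slack_matrix.nonneg_rank_eq[OF pentagon]) simp_all
  next
    case 4
    show ?thesis unfolding 4
    proof (rule hexagon.nonneg_rank_eq)
      fix d i1 j1 i2 j2 i3 j3
      assume sub: "{i1, j1, i2, j2, i3, j3} \<subseteq> {..<6}" and dist: "distinct [i1, j1, i2, j2, i3, j3]"
        and lines: "hexagon.on_line d i1 j1" "hexagon.on_line d i2 j2" "hexagon.on_line d i3 j3"
      show False
        by (rule split_six[where T = "hexagon.on_line d", OF sub dist _ lines])
          (erule hexagon.on_line_sym, (rule hexagon_no_concurrent_lines)+)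
    qed simp
  qed
qed

end
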